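(* If $f\in\mathcal{K}_H^0$ and $0\le\alpha<1$, then $f$ is fully convex of order $\alpha$ in $|z|<r_C$, where $r_C$ is the real root in $(0,1)$ of the equation $$2(1-\alpha)(1-r)^4+\alpha(1-r)^2-(r^2+4r+1)=0.$$
   Context: Let $\mathbb{D}=\{z\in\mathbb{C}:|z|<1\}$. $\mathcal{S}_H$ is the class of univalent sense-preserving complex-valued harmonic functions $f=h+\overline{g}$ in $\mathbb{D}$, where $h(z)=z+\sum_{n\ge2}a_nz^n$ and $g(z)=\sum_{n\ge1}b_nz^n$ are analytic in $\mathbb{D}$ and $|g'(z)|<|h'(z)|$ in $\mathbb{D}$. $\mathcal{K}_H^0$ is the class of all $f\in\mathcal{S}_H$ such that $f(\mathbb{D})$ is convex and $f_{\bar z}(0)=0$. A complex-valued harmonic function $f$ is said to be fully convex of order $\alpha$ ($0\le\alpha<1$) in a disk $|z|<\rho$ if, for every $0<r<\rho$, $f$ maps the circle $|z|=r$ in a one-to-one manner onto a convex curve satisfying $\frac{\partial}{\partial\theta}\left(\arg\left\{\frac{\partial}{\partial\theta}f(re^{i\theta})\right\}\right)>\alpha$ for $0\le\theta\le2\pi$. *)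

theory Defs
  imports "HOL-Complex_Analysis.Complex_Analysis"
begin

text \<open>
  The condition \<open>norm (deriv g z) < norm (deriv h z)\<close> says that the Jacobian
  \<open>|h'|\<^sup>2 - |g'|\<^sup>2\<close> of \<open>h + cnj g\<close> is positive, i.e. that the mapping is
  sense-preserving.
\<close>

definition class_SH :: "(complex \<Rightarrow> complex) set" where
  "class_SH = {f. \<exists>h g a b.
     h holomorphic_on ball 0 1 \<and> g holomorphic_on ball 0 1 \<and>
     a 0 = 0 \<and> a 1 = 1 \<and> b 0 = 0 \<and>
     (\<forall>z\<in>ball 0 1. (\<lambda>n::nat. a n * z ^ n) sums h z \<and> (\<lambda>n::nat. b n * z ^ n) sums g z) \<and>
     (\<forall>z\<in>ball 0 1. f z = h z + cnj (g z)) \<and>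
     (\<forall>z\<in>ball 0 1. norm (deriv g z) < norm (deriv h z)) \<and>
     inj_on f (ball 0 1)}"

text \<open>The Wirtinger derivative \<open>(f\<^sub>x + \<i> f\<^sub>y) / 2\<close> of a real-differentiable \<open>f\<close>.\<close>

definition deriv_zbar :: "(complex \<Rightarrow> complex) \<Rightarrow> complex \<Rightarrow> complex" where
  "deriv_zbar f z = (frechet_derivative f (at z) 1 + \<i> * frechet_derivative f (at z) \<i>) / 2"

definition class_KH0 :: "(complex \<Rightarrow> complex) set" where
  "class_KH0 = {f \<in> class_SH. convex (f ` ball 0 1) \<and> deriv_zbar f 0 = 0}"

text \<open>A closed convex curve: the boundary of a planar convex body.\<close>

definition convex_curve :: "complex set \<Rightarrow> bool" where
  "convex_curve \<Gamma> \<longleftrightarrow>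
     (\<exists>K. convex K \<and> compact K \<and> interior K \<noteq> {} \<and> \<Gamma> = frontier K)"

text \<open>
  Here \<open>T \<theta>\<close> is the tangent vector of \<open>\<theta> \<mapsto> f (r e\<^sup>i\<^sup>\<theta>)\<close> and \<open>\<phi>\<close> is a branch of its
  argument along the whole circle. The principal value \<^const>\<open>Arg\<close> would not do, because
  it jumps. Two branches that are differentiable at \<open>\<theta>\<close> have the same derivative there.
\<close>

definition fully_convex_of_order :: "real \<Rightarrow> (complex \<Rightarrow> complex) \<Rightarrow> real \<Rightarrow> bool" where
  "fully_convex_of_order \<alpha> f \<rho> \<longleftrightarrow>
     (\<forall>r. 0 < r \<and> r < \<rho> \<longrightarrow>
        inj_on f (sphere 0 r) \<and> convex_curve (f ` sphere 0 r) \<and>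
        (\<exists>(T :: real \<Rightarrow> complex) (\<phi> :: real \<Rightarrow> real).
           (\<forall>\<theta>. ((\<lambda>t. f (of_real r * cis t)) has_vector_derivative T \<theta>) (at \<theta>) \<and>
                T \<theta> \<noteq> 0 \<and> T \<theta> = of_real (norm (T \<theta>)) * cis (\<phi> \<theta>)) \<and>
           (\<forall>\<theta>. \<phi> differentiable at \<theta>) \<and>
           (\<forall>\<theta>\<in>{0..2 * pi}. deriv \<phi> \<theta> > \<alpha>)))"

end

theory Submission
  imports Defs
begin

text \<open>
  Let \<open>f = h + cnj g\<close>, let \<open>T\<close> be the
  tangent of \<open>f\<close> along \<open>|z| = r\<close>, and rotate by a unit \<open>e\<close> such that \<open>e T = \<i> \<tau>\<close> with \<open>\<tau> > 0\<close> at a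
  given point \<open>z\<close>. By the shear construction of Clunie and Sheil-Small, \<open>F = e h + cnj e g\<close> is
  univalent, and \<open>Re F = Re (e f)\<close>. Hence \<open>s = z F'(z)\<close> is real, and the tangent turns at the rate
  \<open>(s / \<tau>) Re (1 + z F''(z) / F'(z))\<close>. The Schwarz lemma for the dilatation \<open>g' / h'\<close> gives
  \<open>s / \<tau> \<ge> (1 - r) / (1 + r)\<close>, and Bieberbach's bound on the second coefficient, applied to the
  Koebe transform of \<open>F\<close>, gives \<open>Re (1 + z F'' / F') \<ge> (1 - 4 r + r\<^sup>2) / (1 - r\<^sup>2)\<close>. So the rate is at
  least \<open>1 - 6 r / (1 + r)\<^sup>2 > 1 - 6 r\<close>, while positivity of the polynomial at \<open>r\<close> forces
  \<open>6 r < 1 - \<alpha>\<close>. A closed curve whose tangent angle increases by \<open>2\<pi>\<close> in total lies on one side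
  of each of its tangents, so it bounds a convex set.
\<close>

text \<open>The rotation has to depend on the point because a shear preserves real parts only, so
  the analytic \<open>F\<close> can replace \<open>e f\<close> only in quantities read off from real
  parts. With \<open>e T = \<i> \<tau>\<close> the tangent of \<open>e f\<close> has real part 0,
  hence so has the tangent \<open>\<i> z F'\<close> of \<open>F\<close>; and the turning rate
  \<open>Im (T' / T)\<close> equals \<open>- Re (e T') / \<tau>\<close>, again a real part.
  Convexity of the image in every direction makes each \<open>e\<close> admissible. The shear hands
  down univalence, so the bound on \<open>Re (1 + z F'' / F')\<close> is the one valid for all
  univalent functions. The polynomial is \<open>(1 - r)^4\<close> times \<open>1 - \<alpha>\<close>
  minus the sum over n >= 2 of \<open>(n^3 - \<alpha> n) r^(n-1)\<close>, the shape of a coefficient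
  criterion. The summand n = 2 alone exceeds \<open>6 r\<close>, which is why the coarse bound
  \<open>1 - 6 r\<close> on the turning rate suffices up to the root. Positive curvature is local
  and would permit a curve that winds several times. The tangent angle is therefore built as an
  explicit function equal to \<theta> plus a periodic term, which fixes the total turning.\<close>

section \<open>Area of the image of a rectangle\<close>

text \<open>Lebesgue measure is taken in \<open>real^2\<close> because the change of variables theorem of the library
  is stated for \<open>real^'n\<close> only.\<close>

lemma exists_2: "(\<exists>i::2. P i) \<longleftrightarrow> P 1 \<or> P 2"
  using forall_2[of "\<lambda>i. \<not> P i"] by blast

section \<open>Transfer between the complex plane and \<open>real^2\<close>\<close>

definition complex_of_vec :: "real^2 \<Rightarrow> complex" where "complex_of_vec x = Complex (x $ 1) (x $ 2)"
definition vec_of_complex :: "complex \<Rightarrow> real^2" where "vec_of_complex z = vector [Re z, Im z]"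

lemma vec_of_complex_nth [simp]: "vec_of_complex z $ 1 = Re z" "vec_of_complex z $ 2 = Im z"
  by (simp_all add: vec_of_complex_def)
lemma Re_complex_of_vec [simp]: "Re (complex_of_vec x) = x $ 1" and Im_complex_of_vec [simp]: "Im (complex_of_vec x) = x $ 2"
  by (simp_all add: complex_of_vec_def)
lemma complex_of_vec_of_complex [simp]: "complex_of_vec (vec_of_complex z) = z"
  by (simp add: complex_eq_iff)
lemma vec_of_complex_of_vec [simp]: "vec_of_complex (complex_of_vec x) = x"
  by (simp add: vec_eq_iff forall_2)

lemma norm_vec_of_complex [simp]: "norm (vec_of_complex z) = cmod z"
  by (simp add: norm_vec_def L2_set_def sum_2 cmod_def)

lemma linear_vec_of_complex: "linear vec_of_complex"
  by (rule linearI) (simp_all add: vec_eq_iff forall_2)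
lemma linear_complex_of_vec: "linear complex_of_vec"
  by (rule linearI) (simp_all add: complex_eq_iff)

lemma vec_of_complex_image_cball: "vec_of_complex ` cball 0 k = cball 0 k"
proof -
  have "x \<in> vec_of_complex ` cball 0 k" if "x \<in> cball 0 k" for x
    using that by (intro image_eqI[of x vec_of_complex "complex_of_vec x"]) (auto simp flip: norm_vec_of_complex)
  then show ?thesis by auto
qed

lemma vec_of_complex_image_box: "vec_of_complex ` box a b = box (vec_of_complex a) (vec_of_complex b)"
proof -
  have "x \<in> vec_of_complex ` box a b" if "x \<in> box (vec_of_complex a) (vec_of_complex b)" for x
    using that by (intro image_eqI[of x vec_of_complex "complex_of_vec x"]) (auto simp: mem_box_cart in_box_complex_iff forall_2)
  then show ?thesis by (auto simp: mem_box_cart in_box_complex_iff forall_2)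
qed

text \<open>Every real-linear map of the plane has the form \<open>p * z + q * cnj z\<close>. The
  case \<open>q = 0\<close> is the derivative of a holomorphic map; general \<open>q\<close> gives
  the ellipse of the area theorem.\<close>

lemma det_matrix_complex:
  "det (matrix (\<lambda>v. vec_of_complex (p * complex_of_vec v + q * cnj (complex_of_vec v)))) = (cmod p)\<^sup>2 - (cmod q)\<^sup>2"
  by (simp add: det_2 matrix_def axis_def cmod_power2) (simp add: algebra_simps power2_eq_square)

lemma has_derivative_vec_of_complex_of_vec:
  assumes "(\<Phi> has_field_derivative D) (at (complex_of_vec x))"
  shows "((\<lambda>v. vec_of_complex (\<Phi> (complex_of_vec v))) has_derivative (\<lambda>v. vec_of_complex (D * complex_of_vec v))) (at x)"
proof -
  have "(\<Phi> \<circ> complex_of_vec has_derivative ((*) D \<circ> complex_of_vec)) (at x)"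
    using assms by (intro diff_chain_at linear_imp_has_derivative linear_complex_of_vec) (simp add: has_field_derivative_def)
  then have "(vec_of_complex \<circ> (\<Phi> \<circ> complex_of_vec) has_derivative (vec_of_complex \<circ> ((*) D \<circ> complex_of_vec))) (at x)"
    by (rule diff_chain_at) (rule linear_imp_has_derivative[OF linear_vec_of_complex])
  then show ?thesis by (simp add: o_def)
qed

lemma measure_vec_of_complex_ellipse:
  assumes "k \<ge> 0"
  shows "vec_of_complex ` (\<lambda>z. p * z + q * cnj z) ` cball 0 k \<in> lmeasurable"
    and "measure lebesgue (vec_of_complex ` (\<lambda>z. p * z + q * cnj z) ` cball 0 k) = \<bar>(cmod p)\<^sup>2 - (cmod q)\<^sup>2\<bar> * (pi * k\<^sup>2)"
proof -
  let ?L = "\<lambda>v. vec_of_complex (p * complex_of_vec v + q * cnj (complex_of_vec v))"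
  have lin: "linear ?L"
    by (rule linearI) (simp_all add: vec_eq_iff forall_2 algebra_simps)
  have eq: "vec_of_complex ` (\<lambda>z. p * z + q * cnj z) ` cball 0 k = ?L ` cball 0 k"
    unfolding vec_of_complex_image_cball[symmetric] by (simp add: image_image)
  show "vec_of_complex ` (\<lambda>z. p * z + q * cnj z) ` cball 0 k \<in> lmeasurable"
    unfolding eq using lin by (intro measurable_linear_image) auto
  show "measure lebesgue (vec_of_complex ` (\<lambda>z. p * z + q * cnj z) ` cball 0 k) = \<bar>(cmod p)\<^sup>2 - (cmod q)\<^sup>2\<bar> * (pi * k\<^sup>2)"
    unfolding eq using lin assms
    by (subst measure_linear_image) (auto simp: det_matrix_complex content_cball unit_ball_vol_2 mult_ac)
qed

text \<open>The coordinate map \<open>h\<close> is a linear bijection that carries boxes to boxes of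
  equal content, so integrals transport along it and Fubini on the product of two lines
  applies.\<close>

lemma integral_cbox_real2:
  fixes f :: "real^2 \<Rightarrow> real"
  assumes "continuous_on (cbox (vector [a, c]) (vector [b, d])) f"
  shows "integral (cbox (vector [a, c]) (vector [b, d])) f =
           integral {a..b} (\<lambda>s. integral {c..d} (\<lambda>t. f (vector [s, t])))"
proof -
  define g :: "real^2 \<Rightarrow> real \<times> real" where "g = (\<lambda>x. (x $ 1, x $ 2))"
  define h :: "real \<times> real \<Rightarrow> real^2" where "h = (\<lambda>p. vector [fst p, snd p])"
  have h1: "h p $ 1 = fst p" "h p $ 2 = snd p" for p by (simp_all add: h_def)
  have hg: "h (g x) = x" for x by (simp add: vec_eq_iff forall_2 h1 g_def)
  have gh: "g (h x) = x" for x by (simp add: h1 g_def)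
  have linh: "linear h" by (rule linearI) (simp_all add: vec_eq_iff forall_2 h1)
  have him: "h ` cbox u v = cbox (h u) (h v)" for u v
  proof -
    have "x \<in> h ` cbox u v" if "x \<in> cbox (h u) (h v)" for x
      using that by (intro image_eqI[of x h "g x"]) (auto simp: vec_eq_iff g_def h1 mem_box_cart forall_2 cbox_Pair_iff[of _ _ "fst u" "snd u" "fst v" "snd v", simplified])
    then show ?thesis
      by (auto simp: h1 mem_box_cart forall_2 cbox_Pair_iff[of _ _ "fst u" "snd u" "fst v" "snd v", simplified])
  qed
  have gim: "g ` cbox u v = cbox (g u) (g v)" for u v
  proof -
    have "cbox u v = h ` cbox (g u) (g v)" by (simp add: him hg)
    then show ?thesis by (simp add: image_image gh)
  qed
  have cont: "measure lborel (h ` cbox u v) = measure lborel (cbox u v)" for u v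
  proof -
    obtain u1 u2 v1 v2 where uv: "u = (u1,u2)" "v = (v1,v2)" by (cases u, cases v) auto
    show ?thesis unfolding him uv content_Pair
      by (cases "u1 \<le> v1"; cases "u2 \<le> v2") (auto simp: content_cbox_if_cart h1 UNIV_2 interval_eq_empty_cart exists_2)
  qed
  have chf: "continuous_on (cbox (a,c) (b,d)) (\<lambda>p. f (h p))"
  proof (rule continuous_on_compose2[OF assms])
    show "continuous_on (cbox (a, c) (b, d)) h" by (rule linear_continuous_on[OF linear_conv_bounded_linear[THEN iffD1, OF linh]])
    show "h ` cbox (a, c) (b, d) \<subseteq> cbox (vector [a, c]) (vector [b, d])"
      by (simp add: him) (simp add: h_def)
  qed
  have "(f has_integral integral (cbox (vector [a, c]) (vector [b, d])) f) (cbox (vector [a, c]) (vector [b, d]))"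
    using assms integrable_continuous by blast
  moreover have "\<exists>w z. h ` cbox u v = cbox w z" "\<exists>w z. g ` cbox u' v' = cbox w z" for u v u' v'
    using him gim by blast+
  moreover have "isCont h x" for x
    by (rule linear_continuous_at[OF linear_conv_bounded_linear[THEN iffD1, OF linh]])
  moreover have "measure lborel (h ` cbox u v) = 1 * measure lborel (cbox u v)" for u v
    by (simp only: cont mult_1)
  ultimately have "((\<lambda>x. f (h x)) has_integral (1/1) *\<^sub>R integral (cbox (vector [a, c]) (vector [b, d])) f)
        (g ` cbox (vector [a, c]) (vector [b, d]))"
    using hg gh by (intro has_integral_twiddle[where r = 1 and g = h and h = g]) (simp only: zero_less_one)+
  then have "((\<lambda>x. f (h x)) has_integral integral (cbox (vector [a, c]) (vector [b, d])) f) (cbox (a,c) (b,d))"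
    by (simp add: gim) (simp add: g_def)
  then have "integral (cbox (vector [a, c]) (vector [b, d])) f = integral (cbox (a,c) (b,d)) (\<lambda>x. f (h x))"
    by (simp add: integral_unique)
  also have "\<dots> = integral {a..b} (\<lambda>s. integral {c..d} (\<lambda>t. f (vector [s, t])))"
    using integral_prod_continuous[OF chf] by (simp add: h_def)
  finally show ?thesis .
qed

text \<open>Change of variables with Jacobian \<open>|\<Phi>'|^2\<close>. Injectivity is asked on
  the open box only: the map used later is a function of \<open>exp w\<close> on a box of height
  \<open>2 * pi\<close>, so it agrees on the two horizontal sides.\<close>

lemma measure_image_box_holomorphic:
  fixes a b c d :: real
  assumes "open U" "cbox (Complex a c) (Complex b d) \<subseteq> U" "\<Phi> holomorphic_on U"
    and inj: "inj_on \<Phi> (box (Complex a c) (Complex b d))"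
  shows "vec_of_complex ` \<Phi> ` box (Complex a c) (Complex b d) \<in> lmeasurable"
    and "measure lebesgue (vec_of_complex ` \<Phi> ` box (Complex a c) (Complex b d)) =
       integral {a..b} (\<lambda>s. integral {c..d} (\<lambda>t. (cmod (deriv \<Phi> (Complex s t)))\<^sup>2))"
proof -
  define B where "B = box (Complex a c) (Complex b d)"
  let ?f = "\<lambda>v. vec_of_complex (\<Phi> (complex_of_vec v))"
  let ?f' = "\<lambda>x v. vec_of_complex (deriv \<Phi> (complex_of_vec x) * complex_of_vec v)"
  let ?A = "vector [a, c] :: real^2" and ?B = "vector [b, d] :: real^2"
  have AB: "vec_of_complex (Complex a c) = ?A" "vec_of_complex (Complex b d) = ?B" by (simp_all add: vec_of_complex_def)
  have img: "vec_of_complex ` \<Phi> ` B = ?f ` box ?A ?B"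
    unfolding B_def AB[symmetric] vec_of_complex_image_box[symmetric] by (simp add: image_image)
  have sub: "complex_of_vec x \<in> U" if "x \<in> cbox ?A ?B" for x
    using that assms(2) by (auto simp: mem_box_cart forall_2 in_cbox_complex_iff subset_iff)
  have der: "(?f has_derivative ?f' x) (at x within box ?A ?B)" if "x \<in> box ?A ?B" for x
  proof -
    have "complex_of_vec x \<in> U" using that sub box_subset_cbox by blast
    then have "(\<Phi> has_field_derivative deriv \<Phi> (complex_of_vec x)) (at (complex_of_vec x))"
      using assms holomorphic_derivI by blast
    from has_derivative_vec_of_complex_of_vec[OF this] show ?thesis by (rule has_derivative_at_withinI)
  qed
  have inj': "inj_on ?f (box ?A ?B)"
  proof (rule inj_onI)
    fix x y assume xy: "x \<in> box ?A ?B" "y \<in> box ?A ?B" "?f x = ?f y"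
    then have "complex_of_vec x \<in> B" "complex_of_vec y \<in> B" by (auto simp: B_def mem_box_cart forall_2 in_box_complex_iff)
    moreover have "\<Phi> (complex_of_vec x) = \<Phi> (complex_of_vec y)" using xy(3) by (metis complex_of_vec_of_complex)
    ultimately show "x = y" using inj unfolding B_def[symmetric] by (metis vec_of_complex_of_vec inj_onD)
  qed
  have det: "\<bar>det (matrix (?f' x))\<bar> = (cmod (deriv \<Phi> (complex_of_vec x)))\<^sup>2" for x
    using det_matrix_complex[of "deriv \<Phi> (complex_of_vec x)" 0] by simp
  have "deriv \<Phi> holomorphic_on U"
    by (rule holomorphic_deriv[OF assms(3,1)])
  then have "continuous_on U (deriv \<Phi>)"
    by (rule holomorphic_on_imp_continuous_on)
  moreover have "continuous_on (cbox ?A ?B) complex_of_vec"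
    by (rule linear_continuous_on[OF linear_conv_bounded_linear[THEN iffD1, OF linear_complex_of_vec]])
  ultimately have "continuous_on (cbox ?A ?B) (\<lambda>x. deriv \<Phi> (complex_of_vec x))"
    by (rule continuous_on_compose2) (use sub in blast)
  then have cont: "continuous_on (cbox ?A ?B) (\<lambda>x. (cmod (deriv \<Phi> (complex_of_vec x)))\<^sup>2)"
    by (intro continuous_on_power continuous_on_norm)
  have int: "(\<lambda>x. \<bar>det (matrix (?f' x))\<bar>) integrable_on box ?A ?B"
    unfolding det integrable_on_open_interval using cont by (rule integrable_continuous)
  have S: "box ?A ?B \<in> sets lebesgue" by simp
  show "vec_of_complex ` \<Phi> ` box (Complex a c) (Complex b d) \<in> lmeasurable"
    unfolding img B_def[symmetric] by (rule measurable_differentiable_image_eq[OF S der inj', THEN iffD2]) (assumption | rule int)+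
  have "measure lebesgue (vec_of_complex ` \<Phi> ` B) = integral (cbox ?A ?B) (\<lambda>x. (cmod (deriv \<Phi> (complex_of_vec x)))\<^sup>2)"
    unfolding img integral_open_interval[symmetric] det[symmetric]
    by (rule measure_differentiable_image_eq[OF S der inj' int])
  also have "\<dots> = integral {a..b} (\<lambda>s. integral {c..d} (\<lambda>t. (cmod (deriv \<Phi> (complex_of_vec (vector [s, t]))))\<^sup>2))"
    by (rule integral_cbox_real2[OF cont])
  finally show "measure lebesgue (vec_of_complex ` \<Phi> ` box (Complex a c) (Complex b d)) =
       integral {a..b} (\<lambda>s. integral {c..d} (\<lambda>t. (cmod (deriv \<Phi> (Complex s t)))\<^sup>2))"
    by (simp add: complex_of_vec_def B_def)
qed

section \<open>The area theorem and the second coefficient of a univalent function\<close>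

text \<open>Cauchy's formula for the k-th derivative on \<open>|z| = r\<close>, parametrised by the
  angle: Taylor coefficients are Fourier coefficients.\<close>

lemma has_integral_Taylor_coefficient:
  fixes N :: "complex \<Rightarrow> complex"
  assumes "N holomorphic_on ball 0 1" "0 < r" "r < 1"
  shows "((\<lambda>t. N (r * cis t) * cis (- (real k * t))) has_integral
            2 * pi * r ^ k * (deriv ^^ k) N 0 / fact k) {0..2 * pi}"
proof -
  have cont: "continuous_on (cball 0 r) N"
    using assms by (intro holomorphic_on_imp_continuous_on holomorphic_on_subset[OF assms(1)]) auto
  have hol: "N holomorphic_on ball 0 r"
    using assms by (intro holomorphic_on_subset[OF assms(1)]) auto
  have "((\<lambda>u. N u / (u - 0) ^ (Suc k)) has_contour_integral ((2 * pi * \<i>) / (fact k) * (deriv ^^ k) N 0))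
           (circlepath 0 r)"
    using assms by (intro Cauchy_has_contour_integral_higher_derivative_circlepath cont hol) auto
  then have "((\<lambda>t. N (0 + r * cis t) / (0 + r * cis t - 0) ^ Suc k * r * \<i> * cis t) has_integral
               (2 * pi * \<i>) / (fact k) * (deriv ^^ k) N 0) {0..2 * pi}"
    unfolding circlepath_def by (subst (asm) has_contour_integral_part_circlepath_iff) auto
  from has_integral_mult_right[OF this, of "r ^ k / \<i>"]
  have "((\<lambda>t. r ^ k / \<i> * (N (r * cis t) / (r * cis t) ^ Suc k * r * \<i> * cis t)) has_integral
               r ^ k / \<i> * ((2 * pi * \<i>) / (fact k) * (deriv ^^ k) N 0)) {0..2 * pi}"
    by simp
  moreover have "r ^ k / \<i> * (N (r * cis t) / (r * cis t) ^ Suc k * r * \<i> * cis t) = N (r * cis t) * cis (- (real k * t))" for t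
  proof -
    have "cis (- (real k * t)) = inverse (cis t ^ k)"
      by (simp add: Complex.DeMoivre cis_inverse)
    then show ?thesis using assms by (simp add: field_simps power_mult_distrib)
  qed
  moreover have "r ^ k / \<i> * ((2 * pi * \<i>) / (fact k) * (deriv ^^ k) N 0) = 2 * pi * r ^ k * (deriv ^^ k) N 0 / fact k"
    by (simp add: field_simps)
  ultimately show ?thesis by simp
qed

text \<open>Bessel's inequality for the frequencies 0 and 2: expand
  \<open>|N - P|^2 \<ge> 0\<close>, where \<open>P\<close> consists of these two Fourier terms of
  \<open>N\<close>, and integrate.\<close>

lemma integral_norm_square_ge:
  fixes N :: "complex \<Rightarrow> complex"
  assumes N: "N holomorphic_on ball 0 1" and r: "0 < r" "r < 1"
  defines "n\<^sub>2 \<equiv> deriv (deriv N) 0 / 2"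
  shows "integral {0..2 * pi} (\<lambda>t. (cmod (N (r * cis t)))\<^sup>2) \<ge> 2 * pi * ((cmod (N 0))\<^sup>2 + (cmod n\<^sub>2)\<^sup>2 * r ^ 4)"
proof -
  define P where "P = (\<lambda>t. N 0 + n\<^sub>2 * r\<^sup>2 * cis (2 * t))"
  have I0: "((\<lambda>t. N (r * cis t)) has_integral 2 * pi * N 0) {0..2 * pi}"
    using has_integral_Taylor_coefficient[OF N r, of 0] by simp
  have I2: "((\<lambda>t. N (r * cis t) * cis (- (2 * t))) has_integral 2 * pi * r\<^sup>2 * n\<^sub>2) {0..2 * pi}"
    using has_integral_Taylor_coefficient[OF N r, of 2] by (simp add: n\<^sub>2_def numeral_2_eq_2)
  have J2: "((\<lambda>t. cis (- (2 * t))) has_integral 0) {0..2 * pi}"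
    using has_integral_Taylor_coefficient[of "\<lambda>_. 1", OF _ r, of 2] by (simp add: numeral_2_eq_2)
  \<comment> \<open>The real part of this integrand is \<open>|N|^2 - |N - P|^2\<close>. The last
    term is the cross term of the two summands of \<open>P\<close>; it integrates to 0 by
    \<open>J2\<close>.\<close>
  have "((\<lambda>t. 2 * (N (r * cis t) * cnj (N 0) + N (r * cis t) * cis (- (2 * t)) * (cnj n\<^sub>2 * r\<^sup>2))
            - ((cmod (N 0))\<^sup>2 + (cmod n\<^sub>2)\<^sup>2 * r ^ 4) - cis (- (2 * t)) * (2 * N 0 * cnj n\<^sub>2 * r\<^sup>2)) has_integral
          2 * (2 * pi * N 0 * cnj (N 0) + 2 * pi * r\<^sup>2 * n\<^sub>2 * (cnj n\<^sub>2 * r\<^sup>2))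
            - (2 * pi) *\<^sub>R ((cmod (N 0))\<^sup>2 + (cmod n\<^sub>2)\<^sup>2 * r ^ 4) - 0 * (2 * N 0 * cnj n\<^sub>2 * r\<^sup>2)) {0..2 * pi}"
    using has_integral_const_real[of "complex_of_real ((cmod (N 0))\<^sup>2 + (cmod n\<^sub>2)\<^sup>2 * r ^ 4)" 0 "2 * pi"]
    unfolding scaleR_conv_of_real
    by (intro has_integral_diff has_integral_add has_integral_mult_right has_integral_mult_left I0 I2 J2) simp_all
  then have "((\<lambda>t. 2 * (N (r * cis t) * cnj (N 0) + N (r * cis t) * cis (- (2 * t)) * (cnj n\<^sub>2 * r\<^sup>2))
            - ((cmod (N 0))\<^sup>2 + (cmod n\<^sub>2)\<^sup>2 * r ^ 4) - cis (- (2 * t)) * (2 * N 0 * cnj n\<^sub>2 * r\<^sup>2)) has_integral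
          complex_of_real (2 * pi * ((cmod (N 0))\<^sup>2 + (cmod n\<^sub>2)\<^sup>2 * r ^ 4))) {0..2 * pi}"
    unfolding scaleR_conv_of_real of_real_mult of_real_add complex_norm_square
    by (rule has_integral_eq_rhs) (simp add: algebra_simps power2_eq_square power4_eq_xxxx)
  from has_integral_Re[OF this]
  have I: "((\<lambda>t. Re (2 * (N (r * cis t) * cnj (N 0) + N (r * cis t) * cis (- (2 * t)) * (cnj n\<^sub>2 * r\<^sup>2))
            - ((cmod (N 0))\<^sup>2 + (cmod n\<^sub>2)\<^sup>2 * r ^ 4) - cis (- (2 * t)) * (2 * N 0 * cnj n\<^sub>2 * r\<^sup>2))) has_integral
          2 * pi * ((cmod (N 0))\<^sup>2 + (cmod n\<^sub>2)\<^sup>2 * r ^ 4)) {0..2 * pi}"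
    by (simp only: Re_complex_of_real)
  have le: "Re (2 * (N (r * cis t) * cnj (N 0) + N (r * cis t) * cis (- (2 * t)) * (cnj n\<^sub>2 * r\<^sup>2))
            - ((cmod (N 0))\<^sup>2 + (cmod n\<^sub>2)\<^sup>2 * r ^ 4) - cis (- (2 * t)) * (2 * N 0 * cnj n\<^sub>2 * r\<^sup>2)) \<le> (cmod (N (r * cis t)))\<^sup>2" for t
  proof -
    have key: "(cmod (X - (a + b)))\<^sup>2 = (cmod X)\<^sup>2 - Re (2 * (X * cnj a + X * cnj b) - ((cmod a)\<^sup>2 + (cmod b)\<^sup>2) - 2 * a * cnj b)" for X a b
      unfolding cmod_power2 by (simp add: cmod_power2) (simp add: power2_eq_square algebra_simps)
    have "cmod (n\<^sub>2 * r\<^sup>2 * cis (2 * t)) = cmod n\<^sub>2 * r\<^sup>2" by (simp add: norm_mult norm_power)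
    moreover have "cnj (n\<^sub>2 * r\<^sup>2 * cis (2 * t)) = cnj n\<^sub>2 * r\<^sup>2 * cis (- (2 * t))" by (simp add: cis_cnj)
    ultimately have "(cmod (N (r * cis t) - P t))\<^sup>2 = (cmod (N (r * cis t)))\<^sup>2 - Re (2 * (N (r * cis t) * cnj (N 0) + N (r * cis t) * cis (- (2 * t)) * (cnj n\<^sub>2 * r\<^sup>2))
            - ((cmod (N 0))\<^sup>2 + (cmod n\<^sub>2)\<^sup>2 * r ^ 4) - cis (- (2 * t)) * (2 * N 0 * cnj n\<^sub>2 * r\<^sup>2))"
      unfolding P_def key by (simp add: power_mult_distrib algebra_simps)
    then show ?thesis by (smt (verit) zero_le_power2)
  qed
  have "continuous_on {0..2*pi} (\<lambda>t. N (r * cis t))"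
    by (rule continuous_on_compose2[OF holomorphic_on_imp_continuous_on[OF N]])
       (use r in \<open>auto intro!: continuous_intros simp: norm_mult\<close>)
  then have "((\<lambda>t. (cmod (N (r * cis t)))\<^sup>2) has_integral integral {0..2 * pi} (\<lambda>t. (cmod (N (r * cis t)))\<^sup>2)) {0..2 * pi}"
    by (intro integrable_integral integrable_continuous_real continuous_intros)
  from has_integral_le[OF I this le] show ?thesis .
qed

section \<open>The area theorem for \<open>m(z^2) / z\<close>\<close>

lemma has_field_derivative_compose_square:
  assumes "(f has_field_derivative D) (at (z\<^sup>2))"
  shows "((\<lambda>z. f (z\<^sup>2)) has_field_derivative 2 * z * D) (at z)"
proof -
  have "((\<lambda>z. z\<^sup>2) has_field_derivative 2 * z) (at z)"
    by (auto intro!: derivative_eq_intros)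
  from DERIV_chain2[where g = "\<lambda>z. z\<^sup>2", OF assms this] show ?thesis
    by (simp add: mult_ac)
qed

text \<open>The logarithmic coordinate \<open>z = exp w\<close> turns the annulus \<open>\<delta> < |z| < \<rho>\<close> into a rectangle.\<close>

lemma area_punctured_disc_ge:
  assumes m: "m holomorphic_on ball 0 1" and m0: "m 0 = 1"
    and inj: "inj_on (\<lambda>z. m (z\<^sup>2) / z) (ball 0 1 - {0})"
    and \<delta>: "0 < \<delta>" "\<delta> < \<rho>" "\<rho> < 1"
  obtains S where "S \<subseteq> (\<lambda>z. m (z\<^sup>2) / z) ` (ball 0 1 - ball 0 \<delta>)" "vec_of_complex ` S \<in> lmeasurable"
    "measure lebesgue (vec_of_complex ` S) \<ge> pi * (1 / \<delta>\<^sup>2 - 1 / \<rho>\<^sup>2) + pi * (cmod (deriv m 0))\<^sup>2 * (\<rho>\<^sup>2 - \<delta>\<^sup>2)"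
proof -
  define G where "G = (\<lambda>z. m (z\<^sup>2) / z)"
  \<comment> \<open>\<open>N z = z^2 G'(z)\<close> is free of the pole of \<open>G\<close>, and the
    derivative of \<Phi> at \<open>w\<close> is \<open>N z / z\<close> with
    \<open>z = exp w\<close>.\<close>
  define N where "N = (\<lambda>z. 2 * z\<^sup>2 * deriv m (z\<^sup>2) - m (z\<^sup>2))"
  define \<Phi> where "\<Phi> = (\<lambda>w. G (exp w))"
  define U where "U = {w. Re w < 0}"
  define B where "B = box (Complex (ln \<delta>) 0) (Complex (ln \<rho>) (2 * pi))"
  have sq: "z\<^sup>2 \<in> ball 0 1" if "z \<in> ball 0 1" for z :: complex
    using that by (simp add: norm_power power_less_one_iff)
  have dm: "deriv m holomorphic_on ball 0 1" using m by (rule holomorphic_deriv) simp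
  have hm2: "(\<lambda>z. m (z\<^sup>2)) holomorphic_on ball 0 1" and hdm2: "(\<lambda>z. deriv m (z\<^sup>2)) holomorphic_on ball 0 1"
    using sq by (auto intro!: holomorphic_on_compose_gen[OF _ m, unfolded o_def] holomorphic_on_compose_gen[OF _ dm, unfolded o_def] holomorphic_intros)
  have N: "N holomorphic_on ball 0 1"
    unfolding N_def by (intro holomorphic_intros hm2 hdm2)
  have expU: "exp w \<in> ball 0 1 - {0}" if "w \<in> U" for w
    using that by (simp add: U_def)
  have openU: "open U" unfolding U_def by (rule open_halfspace_Re_lt)
  have dm2: "((\<lambda>z. m (z\<^sup>2)) has_field_derivative 2 * z * deriv m (z\<^sup>2)) (at z)" if "z \<in> ball 0 1" for z
  proof -
    have "(m has_field_derivative deriv m (z\<^sup>2)) (at (z\<^sup>2))"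
      by (rule holomorphic_derivI[OF m open_ball sq[OF that]])
    then show ?thesis by (rule has_field_derivative_compose_square)
  qed
  have d\<Phi>: "(\<Phi> has_field_derivative N (exp w) / exp w) (at w)" if "w \<in> U" for w
  proof -
    have "exp w \<in> ball 0 1" using expU[OF that] by simp
    from DERIV_chain2[where g = exp, OF dm2[OF this] DERIV_exp]
    have "((\<lambda>w. m ((exp w)\<^sup>2)) has_field_derivative 2 * exp w * deriv m ((exp w)\<^sup>2) * exp w) (at w)" .
    from DERIV_divide[OF this DERIV_exp] show ?thesis unfolding \<Phi>_def G_def N_def
      by (rule DERIV_cong) (simp_all add: power2_eq_square field_simps)
  qed
  have hol: "\<Phi> holomorphic_on U"
    using d\<Phi> openU by (simp add: holomorphic_on_open) blast
  have BU: "cbox (Complex (ln \<delta>) 0) (Complex (ln \<rho>) (2 * pi)) \<subseteq> U"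
  proof
    fix w assume "w \<in> cbox (Complex (ln \<delta>) 0) (Complex (ln \<rho>) (2 * pi))"
    then have "Re w \<le> ln \<rho>" by (simp add: in_cbox_complex_iff)
    also have "ln \<rho> < 0" using \<delta> by simp
    finally show "w \<in> U" by (simp add: U_def)
  qed
  then have BU': "B \<subseteq> U" using box_subset_cbox unfolding B_def by blast
  have inj\<Phi>: "inj_on \<Phi> B"
  proof (rule inj_onI)
    fix w w' assume w: "w \<in> B" "w' \<in> B" "\<Phi> w = \<Phi> w'"
    then have "exp w = exp w'"
      using inj expU BU' unfolding \<Phi>_def G_def inj_on_def by blast
    moreover have "\<bar>Im w - Im w'\<bar> < 2 * pi"
      using w unfolding B_def by (auto simp: in_box_complex_iff)
    ultimately show "w = w'" by (intro complex_eqI) (auto dest: exp_complex_eqI)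
  qed
  note area = measure_image_box_holomorphic[OF openU BU hol inj\<Phi>[unfolded B_def]]
  have N0: "N 0 = -1" by (simp add: N_def m0)
  \<comment> \<open>\<open>N\<close> begins with \<open>-1 + m'(0) z^2\<close>, so the two Fourier
    coefficients kept by Bessel's inequality are those of the pole and of the number to be
    estimated.\<close>
  have N2: "deriv (deriv N) 0 / 2 = deriv m 0"
  proof -
    have e: "eventually (\<lambda>z. z \<in> ball 0 1) (nhds (0::complex))" by (rule eventually_nhds_in_open) auto
    have d2: "((\<lambda>z. deriv m (z\<^sup>2)) has_field_derivative 2 * z * deriv (deriv m) (z\<^sup>2)) (at z)" if "z \<in> ball 0 1" for z
    proof -
      have "(deriv m has_field_derivative deriv (deriv m) (z\<^sup>2)) (at (z\<^sup>2))"
        by (rule holomorphic_derivI[OF dm open_ball sq[OF that]])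
      then show ?thesis by (rule has_field_derivative_compose_square)
    qed
    have dN: "(N has_field_derivative 2 * z * deriv m (z\<^sup>2) + 4 * z ^ 3 * deriv (deriv m) (z\<^sup>2)) (at z)" if "z \<in> ball 0 1" for z
      unfolding N_def using dm2[OF that] d2[OF that]
      by (auto intro!: derivative_eq_intros simp: power2_eq_square power3_eq_cube algebra_simps)
    have ev: "eventually (\<lambda>z. deriv N z = 2 * z * deriv m (z\<^sup>2) + 4 * z ^ 3 * deriv (deriv m) (z\<^sup>2)) (nhds 0)"
      using e by eventually_elim (use dN DERIV_imp_deriv in blast)
    have ddm: "deriv (deriv m) holomorphic_on ball 0 1" using dm by (rule holomorphic_deriv) simp
    have d3: "((\<lambda>z. deriv (deriv m) (z\<^sup>2)) has_field_derivative 2 * z * deriv (deriv (deriv m)) (z\<^sup>2)) (at z)" if "z \<in> ball 0 1" for z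
    proof -
      have "(deriv (deriv m) has_field_derivative deriv (deriv (deriv m)) (z\<^sup>2)) (at (z\<^sup>2))"
        by (rule holomorphic_derivI[OF ddm open_ball sq[OF that]])
      then show ?thesis by (rule has_field_derivative_compose_square)
    qed
    have "((\<lambda>z. 2 * z * deriv m (z\<^sup>2) + 4 * z ^ 3 * deriv (deriv m) (z\<^sup>2)) has_field_derivative 2 * deriv m 0) (at 0)"
      using d2[of 0] d3[of 0] by (auto intro!: derivative_eq_intros)
    then have "deriv (\<lambda>z. 2 * z * deriv m (z\<^sup>2) + 4 * z ^ 3 * deriv (deriv m) (z\<^sup>2)) 0 = 2 * deriv m 0"
      by (rule DERIV_imp_deriv)
    then show ?thesis using deriv_cong_ev[OF ev refl] by simp
  qed
  define c where "c = cmod (deriv m 0)"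
  define I where "I = (\<lambda>s. integral {0..2 * pi} (\<lambda>t. (cmod (deriv \<Phi> (Complex s t)))\<^sup>2))"
  have I_ge: "I s \<ge> 2 * pi * (exp (-2 * s) + c\<^sup>2 * exp (2 * s))" if s: "s < 0" for s
  proof -
    have e: "exp (Complex s t) = exp s * cis t" for t by (simp add: exp_eq_polar)
    have d: "deriv \<Phi> (Complex s t) = N (exp s * cis t) / (exp s * cis t)" for t
      using d\<Phi>[of "Complex s t", THEN DERIV_imp_deriv] s by (simp add: e U_def exp_of_real)
    have "(cmod (deriv \<Phi> (Complex s t)))\<^sup>2 = exp (-2 * s) * (cmod (N (exp s * cis t)))\<^sup>2" for t
    proof -
      have "exp (-2 * s) = (1 / exp s)\<^sup>2"
        by (simp add: exp_minus exp_double power_divide inverse_eq_divide)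
      then show ?thesis
        unfolding d by (simp add: norm_divide norm_mult power_divide)
    qed
    then have "I s = exp (-2 * s) * integral {0..2 * pi} (\<lambda>t. (cmod (N (exp s * cis t)))\<^sup>2)"
      unfolding I_def by simp
    also have "\<dots> \<ge> exp (-2 * s) * (2 * pi * ((cmod (N 0))\<^sup>2 + (cmod (deriv (deriv N) 0 / 2))\<^sup>2 * exp s ^ 4))"
      using s by (intro mult_left_mono integral_norm_square_ge N) auto
    also have "exp (-2 * s) * (2 * pi * ((cmod (N 0))\<^sup>2 + (cmod (deriv (deriv N) 0 / 2))\<^sup>2 * exp s ^ 4)) =
       2 * pi * (exp (-2 * s) + c\<^sup>2 * exp (2 * s))"
      unfolding N2 N0 c_def by (simp add: algebra_simps flip: exp_of_nat_mult exp_add)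
    finally show ?thesis .
  qed
  have ln: "ln \<delta> \<le> ln \<rho>" "ln \<rho> < 0" using \<delta> by simp_all
  have "continuous_on (cbox (ln \<delta>, 0) (ln \<rho>, 2 * pi)) (\<lambda>(s,t). (cmod (deriv \<Phi> (Complex s t)))\<^sup>2)"
  proof -
    have "continuous_on U (deriv \<Phi>)"
      by (rule holomorphic_on_imp_continuous_on[OF holomorphic_deriv[OF hol openU]])
    then have "continuous_on (cbox (ln \<delta>, 0) (ln \<rho>, 2 * pi)) (\<lambda>p. deriv \<Phi> (Complex (fst p) (snd p)))"
    proof (rule continuous_on_compose2)
      show "continuous_on (cbox (ln \<delta>, 0) (ln \<rho>, 2 * pi)) (\<lambda>p. Complex (fst p) (snd p))"
        unfolding Complex_eq by (intro continuous_intros)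
      show "(\<lambda>p. Complex (fst p) (snd p)) ` cbox (ln \<delta>, 0) (ln \<rho>, 2 * pi) \<subseteq> U"
        using ln by (auto simp: U_def)
    qed
    then show ?thesis unfolding case_prod_beta by (intro continuous_intros)
  qed
  then have "I integrable_on cbox (ln \<delta>) (ln \<rho>)"
    unfolding I_def using integral_integrable_2dim by fastforce
  then have II: "(I has_integral integral {ln \<delta>..ln \<rho>} I) {ln \<delta>..ln \<rho>}"
    by (simp add: integrable_integral)
  have "((\<lambda>s. 2 * pi * (exp (-2 * s) + c\<^sup>2 * exp (2 * s))) has_integral
      pi * (- exp (-2 * ln \<rho>) + c\<^sup>2 * exp (2 * ln \<rho>)) - pi * (- exp (-2 * ln \<delta>) + c\<^sup>2 * exp (2 * ln \<delta>))) {ln \<delta>..ln \<rho>}"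
    by (rule fundamental_theorem_of_calculus)
       (use ln in \<open>auto intro!: derivative_eq_intros simp: algebra_simps simp flip: has_real_derivative_iff_has_vector_derivative\<close>)
  from has_integral_le[OF this II]
  have ge: "integral {ln \<delta>..ln \<rho>} I \<ge> pi * (- exp (-2 * ln \<rho>) + c\<^sup>2 * exp (2 * ln \<rho>)) - pi * (- exp (-2 * ln \<delta>) + c\<^sup>2 * exp (2 * ln \<delta>))"
    using I_ge ln by auto
  have e2: "exp (2 * ln x) = x\<^sup>2" "exp (-2 * ln x) = 1 / x\<^sup>2" if "x > 0" for x :: real
    using that by (simp_all add: exp_minus exp_double inverse_eq_divide)
  show ?thesis
  proof (rule that[of "\<Phi> ` B"])
    show "vec_of_complex ` \<Phi> ` B \<in> lmeasurable" unfolding B_def by (rule area(1))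
    show "measure lebesgue (vec_of_complex ` \<Phi> ` B) \<ge> pi * (1 / \<delta>\<^sup>2 - 1 / \<rho>\<^sup>2) + pi * (cmod (deriv m 0))\<^sup>2 * (\<rho>\<^sup>2 - \<delta>\<^sup>2)"
      unfolding B_def area(2) using ge e2[of \<delta>] e2[of \<rho>] \<delta> unfolding I_def c_def by (simp add: algebra_simps)
    have "exp w \<in> ball 0 1 - ball 0 \<delta>" if "w \<in> B" for w
    proof -
      have "ln \<delta> < Re w" using that by (simp add: B_def in_box_complex_iff)
      then have "\<delta> < exp (Re w)" using \<delta> by (metis exp_less_mono exp_ln)
      moreover have "exp w \<in> ball 0 1" using expU BU' that by blast
      ultimately show ?thesis by simp
    qed
    then show "\<Phi> ` B \<subseteq> (\<lambda>z. m (z\<^sup>2) / z) ` (ball 0 1 - ball 0 \<delta>)"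
      unfolding \<Phi>_def G_def by blast
  qed
qed

text \<open>The image of \<open>|z| = \<delta>\<close> under \<open>1 / z + m'(0) z\<close> is an ellipse, and enlarging it by a factor
  \<open>1 + O(\<delta>\<^sup>4)\<close> encloses everything that \<open>m(z\<^sup>2) / z\<close> omits on \<open>0 < |z| < \<delta>\<close>. Hence the image of
  \<open>\<delta> < |z| < \<rho>\<close> has at most the area of this ellipse; then \<open>\<delta> \<longlonglongrightarrow> 0\<close> and \<open>\<rho> \<longlonglongrightarrow> 1\<close>.\<close>

lemma area_theorem:
  assumes m: "m holomorphic_on ball 0 1" and m0: "m 0 = 1" and nz: "\<And>w. w \<in> ball 0 1 \<Longrightarrow> m w \<noteq> 0"
    and inj: "inj_on (\<lambda>z. m (z\<^sup>2) / z) (ball 0 1 - {0})"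
  shows "cmod (deriv m 0) \<le> 1"
proof -
  define c where "c = deriv m 0"
  define G where "G = (\<lambda>z. m (z\<^sup>2) / z)"
  have sq: "z\<^sup>2 \<in> ball 0 1" if "z \<in> ball 0 1" for z :: complex
    using that by (simp add: norm_power power_less_one_iff)
  \<comment> \<open>\<open>Q\<close> is \<open>1 / G\<close> continued over the pole, so the
    behaviour of \<open>G\<close> near infinity can be read off from images of discs about 0 under a
    holomorphic function.\<close>
  define Q where "Q = (\<lambda>z. z / m (z\<^sup>2))"
  have QG: "Q z = 1 / G z" for z by (simp add: Q_def G_def)
  have G0: "G z \<noteq> 0" if "z \<in> ball 0 1 - {0}" for z using that nz[OF sq] by (auto simp: G_def)
  have Q: "Q holomorphic_on ball 0 1"
  proof -
    have "(\<lambda>z. m (z\<^sup>2)) holomorphic_on ball 0 1"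
      using sq by (auto intro!: holomorphic_on_compose_gen[OF _ m, unfolded o_def] holomorphic_intros)
    then show ?thesis unfolding Q_def using nz[OF sq] by (auto intro!: holomorphic_intros)
  qed
  have dm: "deriv m holomorphic_on ball 0 1" using m by (rule holomorphic_deriv) simp
  have ddm: "deriv (deriv m) holomorphic_on ball 0 1" using dm by (rule holomorphic_deriv) simp
  obtain K where K: "K > 0" "\<And>w. w \<in> cball 0 (1/2) \<Longrightarrow> cmod (deriv (deriv m) w) \<le> K"
  proof -
    have "continuous_on (cball 0 (1/2)) (deriv (deriv m))"
      using ddm by (rule holomorphic_on_imp_continuous_on[OF holomorphic_on_subset]) auto
    then have "bounded (deriv (deriv m) ` cball 0 (1/2))"
      by (intro compact_imp_bounded compact_continuous_image) auto
    then obtain K where "K > 0" "\<forall>x\<in>deriv (deriv m) ` cball 0 (1/2). norm x \<le> K"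
      unfolding bounded_pos by blast
    then show ?thesis by (intro that[of K]) auto
  qed
  have taylor: "cmod (m w - (1 + c * w)) \<le> K * (cmod w)\<^sup>2" if "w \<in> cball 0 (1/2)" for w
  proof -
    have "cmod ((deriv ^^ 0) m w - (\<Sum>i\<le>1. (deriv ^^ i) m 0 * (w - 0) ^ i / fact i)) \<le> K * cmod (w - 0) ^ Suc 1 / fact 1"
    proof (rule complex_Taylor[of "cball 0 (1/2)" 1 "\<lambda>i. (deriv ^^ i) m"])
      fix i :: nat and x :: complex assume "x \<in> cball 0 (1/2)" "i \<le> 1"
      then have "x \<in> ball 0 1" "i = 0 \<or> i = 1" by auto
      then show "((deriv ^^ i) m has_field_derivative (deriv ^^ Suc i) m x) (at x within cball 0 (1/2))"
        using holomorphic_derivI[OF m open_ball] holomorphic_derivI[OF dm open_ball]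
        by (auto intro: has_field_derivative_at_within)
    qed (use K that in \<open>auto simp: numeral_2_eq_2\<close>)
    then show ?thesis by (simp add: m0 c_def power2_eq_square)
  qed
  \<comment> \<open>For \<delta> below this bound, \<open>|c| \<delta>^2 \<le> 1/4\<close>, which
    keeps the smaller semi-axis \<open>1/\<delta> - |c| \<delta>\<close> of the ellipse above
    \<open>1/(2 \<delta>)\<close>.\<close>
  define \<delta>\<^sub>0 where "\<delta>\<^sub>0 = 1 / (2 + 2 * cmod c)"
  have \<delta>\<^sub>0: "\<delta>\<^sub>0 > 0" "\<delta>\<^sub>0 \<le> 1 / 2" "cmod c * \<delta>\<^sub>0 \<le> 1 / 2"
    unfolding \<delta>\<^sub>0_def by (auto simp: field_simps add_pos_nonneg)
  have main: "(cmod c)\<^sup>2 * \<rho>\<^sup>2 - 1 / \<rho>\<^sup>2 \<le> (cmod c)\<^sup>2 * \<delta>\<^sup>2 + 4 * K * \<delta>\<^sup>2 + 4 * K\<^sup>2 * \<delta> ^ 6"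
    if \<delta>: "0 < \<delta>" "\<delta> < \<delta>\<^sub>0" and \<rho>: "\<delta> < \<rho>" "\<rho> < 1" for \<delta> \<rho> :: real
  proof -
    have \<delta>1: "\<delta> < 1 / 2" using \<delta> \<delta>\<^sub>0 by linarith
    have c\<delta>: "cmod c * \<delta>\<^sup>2 \<le> 1 / 4"
    proof -
      have "cmod c * \<delta> \<le> 1 / 2" using \<delta> \<delta>\<^sub>0(3) by (smt (verit) mult_left_mono norm_ge_zero)
      then have "(cmod c * \<delta>) * \<delta> \<le> (1/2) * (1/2)" using \<delta> \<delta>1 by (intro mult_mono) auto
      then show ?thesis by (simp add: power2_eq_square)
    qed
    define p q where "p = complex_of_real (1 / \<delta>)" and "q = c * complex_of_real \<delta>"
    \<comment> \<open>On \<open>|z| = \<delta>\<close> the Taylor error \<open>K \<delta>^4\<close>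
      of \<open>m(z^2)\<close> becomes \<open>K \<delta>^3\<close> after division by
      \<open>z\<close>. The inverse of \<open>L\<close> stretches by at most
      \<open>2 \<delta>\<close>, so in the coordinates of the unit disc the error is
      \<open>2 K \<delta>^4\<close>.\<close>
    define k where "k = 1 + 2 * K * \<delta> ^ 4"
    define L where "L = (\<lambda>z. p * z + q * cnj z)"
    define E where "E = L ` cball 0 k"
    have np: "cmod p = 1 / \<delta>" and nq: "cmod q = cmod c * \<delta>" using \<delta> by (simp_all add: p_def q_def norm_mult norm_divide)
    have pq: "cmod p - cmod q \<ge> 1 / (2 * \<delta>)"
    proof -
      have "(1 / \<delta> - cmod c * \<delta>) * \<delta> \<ge> 1 / 2" using c\<delta> \<delta> by (simp add: field_simps power2_eq_square)
      then show ?thesis using \<delta> unfolding np nq by (simp add: field_simps)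
    qed
    have pq0: "cmod p > cmod q" using pq \<delta> by (smt (verit) divide_pos_pos)
    have k1: "k \<ge> 1" using K \<delta> by (simp add: k_def)
    have E_sphere: "G z \<in> E" if z: "cmod z = \<delta>" for z
    proof -
      \<comment> \<open>Since \<open>1 / z = cnj z / \<delta>^2\<close> on this circle, this point
        of modulus 1 satisfies \<open>L \<zeta> = 1 / z + c z\<close>.\<close>
      define \<zeta> where "\<zeta> = cnj z / \<delta>"
      define e where "e = G z - L \<zeta>"
      have z0: "z \<noteq> 0" using z \<delta> by auto
      have zz: "z * cnj z = of_real (\<delta>\<^sup>2)" using z by (metis complex_norm_square)
      have L\<zeta>: "L \<zeta> = 1 / z + c * z"
      proof -
        have "cnj z / of_real (\<delta>\<^sup>2) = 1 / z" using zz z0 \<delta> by (simp add: field_simps)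
        then show ?thesis using \<delta> by (simp add: L_def p_def q_def \<zeta>_def power2_eq_square)
      qed
      have "z\<^sup>2 \<in> cball 0 (1/2)"
        using z \<delta> \<delta>1 mult_mono[of \<delta> "1/2" \<delta> 1] by (simp add: power2_eq_square norm_mult)
      from taylor[OF this] have t: "cmod (m (z\<^sup>2) - (1 + c * z\<^sup>2)) \<le> K * \<delta> ^ 4"
        by (simp add: norm_power z flip: power_mult)
      have "e = (m (z\<^sup>2) - (1 + c * z\<^sup>2)) / z"
        unfolding e_def L\<zeta> G_def using z0 by (simp add: field_simps power2_eq_square)
      then have "cmod e \<le> K * \<delta> ^ 4 / \<delta>" using t \<delta> by (simp add: norm_divide z divide_right_mono)
      then have e: "cmod e \<le> K * \<delta> ^ 3" using \<delta> by (simp add: power_def eval_nat_numeral mult_ac)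
      define D where "D = (cmod p)\<^sup>2 - (cmod q)\<^sup>2"
      have D: "D = (cmod p - cmod q) * (cmod p + cmod q)" by (simp add: D_def algebra_simps power2_eq_square)
      have Dpos: "D > 0" unfolding D using pq0 by (smt (verit) mult_pos_pos norm_ge_zero)
      \<comment> \<open>The preimage of \<open>e\<close> under the real-linear map \<open>L\<close>,
        whose determinant is \<open>D\<close>.\<close>
      define \<eta> where "\<eta> = (cnj p * e - q * cnj e) / of_real D"
      have "L \<eta> = e"
      proof -
        have "p * (cnj p * e - q * cnj e) + q * cnj (cnj p * e - q * cnj e) = (p * cnj p - q * cnj q) * e"
          by (simp add: algebra_simps)
        also have "\<dots> = of_real D * e" unfolding D_def by (simp only: of_real_diff complex_norm_square)
        finally have "p * ((cnj p * e - q * cnj e) / of_real D) + q * (cnj (cnj p * e - q * cnj e) / of_real D) = e"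
          using Dpos by (simp add: field_simps)
        then show ?thesis by (simp add: L_def \<eta>_def)
      qed
      have "cmod (cnj p * e - q * cnj e) \<le> (cmod p + cmod q) * cmod e"
        by (rule order_trans[OF norm_triangle_ineq4]) (simp add: norm_mult algebra_simps)
      then have "cmod \<eta> \<le> (cmod p + cmod q) * cmod e / D"
        unfolding \<eta>_def using Dpos by (simp add: norm_divide divide_right_mono)
      also have "\<dots> = cmod e / (cmod p - cmod q)"
        unfolding D using pq0 by (smt (verit) mult_divide_mult_cancel_left mult.commute norm_ge_zero)
      also have "\<dots> \<le> cmod e / (1 / (2 * \<delta>))"
        using pq pq0 \<delta> by (intro divide_left_mono mult_pos_pos) auto
      also have "\<dots> \<le> K * \<delta> ^ 3 / (1 / (2 * \<delta>))" using e \<delta> by (intro divide_right_mono) auto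
      also have "\<dots> = 2 * K * \<delta> ^ 4" using \<delta> by (simp add: eval_nat_numeral)
      finally have "cmod \<eta> \<le> 2 * K * \<delta> ^ 4" .
      moreover have "cmod \<zeta> = 1" using z \<delta> by (simp add: \<zeta>_def norm_divide)
      ultimately have "\<zeta> + \<eta> \<in> cball 0 k" unfolding k_def using norm_triangle_ineq[of \<zeta> \<eta>] by simp
      moreover have "L (\<zeta> + \<eta>) = G z" using \<open>L \<eta> = e\<close> by (simp add: L_def e_def algebra_simps)
      ultimately show ?thesis unfolding E_def by (metis image_eqI)
    qed
    have linL: "linear L" by (rule linearI) (simp_all add: L_def algebra_simps scaleR_conv_of_real)
    have E: "convex E" "bounded E" "compact E"
      unfolding E_def using linL
      by (auto intro!: convex_linear_image compact_continuous_image linear_continuous_on compact_imp_bounded simp: linear_conv_bounded_linear)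
    have E0: "0 \<in> E" unfolding E_def using k1 by (intro image_eqI[of _ _ 0]) (auto simp: L_def)
    define D where "D = ball 0 \<delta> - {0::complex}"
    have D1: "D \<subseteq> ball 0 1 - {0}" using \<delta>1 by (auto simp: D_def)
    \<comment> \<open>\<open>A\<close> is the part of the image of the punctured disc outside the
      ellipse. It is open in \<open>- E\<close> because \<open>Q\<close> is an open map, closed
      because the circle \<open>|z| = \<delta>\<close> lands in \<open>E\<close>, and nonempty
      because \<open>G\<close> is unbounded near 0. As \<open>- E\<close> is connected, the
      punctured disc covers all of it, and injectivity confines the values of \<open>G\<close> on
      the remaining annulus to \<open>E\<close>.\<close>
    define A where "A = G ` D \<inter> - E"
    have AeqO: "A = - E \<inter> inverse -` (Q ` ball 0 \<delta>)"
    proof -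
      have "w \<in> G ` D \<longleftrightarrow> inverse w \<in> Q ` ball 0 \<delta>" if "w \<notin> E" for w
      proof
        assume "w \<in> G ` D" then show "inverse w \<in> Q ` ball 0 \<delta>"
          unfolding D_def by (auto simp: QG inverse_eq_divide)
      next
        assume "inverse w \<in> Q ` ball 0 \<delta>"
        then obtain z where z: "z \<in> ball 0 \<delta>" "inverse w = Q z" by blast
        have "w \<noteq> 0" using that E0 by auto
        then have "z \<noteq> 0" using z(2) by (auto simp: Q_def)
        moreover have "w = G z" using z(2) by (simp add: QG inverse_eq_divide)
        ultimately show "w \<in> G ` D" using z unfolding D_def by blast
      qed
      then show ?thesis unfolding A_def by blast
    qed
    have AeqC: "A = - E \<inter> inverse -` (Q ` cball 0 \<delta>)"
    proof -
      have "inverse w \<notin> Q ` sphere 0 \<delta>" if "w \<notin> E" for w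
      proof
        assume "inverse w \<in> Q ` sphere 0 \<delta>"
        then obtain z where "cmod z = \<delta>" "inverse w = Q z" by auto
        then have "w = G z" by (simp add: QG inverse_eq_divide)
        then show False using E_sphere[OF \<open>cmod z = \<delta>\<close>] that by simp
      qed
      moreover have "cball 0 \<delta> = ball 0 \<delta> \<union> sphere (0::complex) \<delta>" by auto
      ultimately show ?thesis unfolding AeqO by (auto simp: image_Un)
    qed
    have contI: "continuous_on (- E) inverse" using E0 by (intro continuous_intros) auto
    have injQ: "inj_on Q (ball 0 1)"
    proof (rule inj_onI)
      fix x y assume xy: "x \<in> ball 0 1" "y \<in> ball 0 1" "Q x = Q y"
      show "x = y"
      proof (cases "x = 0 \<or> y = 0")
        case True then show ?thesis using xy nz[OF sq] by (auto simp: Q_def)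
      next
        case False
        then have "G x = G y" using xy G0 by (auto simp: QG)
        then show ?thesis using inj xy False unfolding G_def inj_on_def by blast
      qed
    qed
    have "open (Q ` ball 0 \<delta>)"
      using \<delta> \<delta>1 by (intro open_mapping_thm3 holomorphic_on_subset[OF Q] inj_on_subset[OF injQ]) auto
    then have opA: "openin (top_of_set (- E)) A"
      unfolding AeqO using continuous_openin_preimage_gen[OF contI] by blast
    have "continuous_on (cball 0 \<delta>) Q"
      using \<delta>1 by (intro holomorphic_on_imp_continuous_on holomorphic_on_subset[OF Q]) auto
    then have "closed (Q ` cball 0 \<delta>)" by (intro compact_imp_closed compact_continuous_image) auto
    then have clA: "closedin (top_of_set (- E)) A"
      unfolding AeqC using continuous_closedin_preimage[OF contI] by blast
    have "A \<noteq> {}"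
    proof
      assume Ae: "A = {}"
      obtain M where M: "M > 0" "\<And>w. w \<in> E \<Longrightarrow> cmod w \<le> M" using E(2) unfolding bounded_pos by blast
      have QM: "cmod (Q z) \<ge> 1 / M" if "z \<in> D" for z
      proof -
        have "G z \<in> E" using Ae that unfolding A_def by blast
        then have "cmod (G z) \<le> M" by (rule M)
        moreover have "G z \<noteq> 0" using G0 D1 that by blast
        ultimately show ?thesis using M(1) by (auto simp: QG norm_divide intro!: divide_left_mono)
      qed
      have "isCont Q 0" by (rule DERIV_isCont[OF holomorphic_derivI[OF Q open_ball]]) simp
      moreover have "Q 0 = 0" by (simp add: Q_def)
      ultimately obtain d where d: "d > 0" "\<And>z. cmod z < d \<Longrightarrow> cmod (Q z) < 1 / M"
        using M(1) unfolding isCont_def LIM_def continuous_at_eps_delta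
        by (metis (no_types, lifting) continuous_at_eps_delta diff_zero dist_norm divide_pos_pos zero_less_one \<open>isCont Q 0\<close>)
      define z where "z = complex_of_real (min d \<delta> / 2)"
      have "cmod z < d" "z \<in> D" using d(1) \<delta> unfolding z_def D_def by (auto simp: norm_divide)
      then show False using QM d(2) by fastforce
    qed
    then have "A = - E"
      using opA clA connected_complement_bounded_convex[OF E(2,1)] unfolding connected_clopen by auto
    then have sub: "- E \<subseteq> G ` D" unfolding A_def by blast
    obtain S where S: "S \<subseteq> G ` (ball 0 1 - ball 0 \<delta>)" "vec_of_complex ` S \<in> lmeasurable"
      "measure lebesgue (vec_of_complex ` S) \<ge> pi * (1 / \<delta>\<^sup>2 - 1 / \<rho>\<^sup>2) + pi * (cmod (deriv m 0))\<^sup>2 * (\<rho>\<^sup>2 - \<delta>\<^sup>2)"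
      using area_punctured_disc_ge[OF m m0 inj \<delta>(1) \<rho>] unfolding G_def by blast
    have "G z \<in> E" if z: "z \<in> ball 0 1 - ball 0 \<delta>" for z
    proof (rule ccontr)
      assume "G z \<notin> E"
      then obtain z' where z': "z' \<in> D" "G z = G z'" using sub by blast
      have "z \<in> ball 0 1 - {0}" using z \<delta> by auto
      then have "z = z'" using inj z' D1 unfolding inj_on_def G_def by blast
      then show False using z z' by (auto simp: D_def)
    qed
    then have "S \<subseteq> E" using S(1) by blast
    have "k \<ge> 0" using k1 by simp
    note ell = measure_vec_of_complex_ellipse[OF this, of p q]
    have "measure lebesgue (vec_of_complex ` S) \<le> measure lebesgue (vec_of_complex ` E)"
      using \<open>S \<subseteq> E\<close> S(2) ell(1) unfolding E_def L_def by (intro measure_mono_fmeasurable) auto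
    also have "\<dots> = \<bar>(cmod p)\<^sup>2 - (cmod q)\<^sup>2\<bar> * (pi * k\<^sup>2)" using ell(2) unfolding E_def L_def .
    also have "\<dots> \<le> 1 / \<delta>\<^sup>2 * (pi * k\<^sup>2)"
    proof (rule mult_right_mono)
      have "(cmod q)\<^sup>2 \<le> (cmod p)\<^sup>2" using pq0 by (intro power_mono) auto
      then show "\<bar>(cmod p)\<^sup>2 - (cmod q)\<^sup>2\<bar> \<le> 1 / \<delta>\<^sup>2" by (simp add: np power_divide)
    qed auto
    finally have "pi * (1 / \<delta>\<^sup>2 - 1 / \<rho>\<^sup>2 + (cmod c)\<^sup>2 * (\<rho>\<^sup>2 - \<delta>\<^sup>2)) \<le> pi * (k\<^sup>2 / \<delta>\<^sup>2)"
      using S(3) by (simp add: c_def algebra_simps)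
    then have "1 / \<delta>\<^sup>2 - 1 / \<rho>\<^sup>2 + (cmod c)\<^sup>2 * (\<rho>\<^sup>2 - \<delta>\<^sup>2) \<le> k\<^sup>2 / \<delta>\<^sup>2"
      by (rule mult_left_le_imp_le) simp
    also have "k\<^sup>2 / \<delta>\<^sup>2 = 1 / \<delta>\<^sup>2 + 4 * K * \<delta>\<^sup>2 + 4 * K\<^sup>2 * \<delta> ^ 6"
      unfolding k_def using \<delta> by (simp add: power2_eq_square field_simps eval_nat_numeral)
    finally show ?thesis by (simp add: algebra_simps)
  qed
  have lim: "(cmod c)\<^sup>2 * \<rho>\<^sup>2 - 1 / \<rho>\<^sup>2 \<le> 0" if \<rho>: "0 < \<rho>" "\<rho> < 1" for \<rho> :: real
  proof (rule tendsto_lowerbound)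
    have "((\<lambda>\<delta>. (cmod c)\<^sup>2 * \<delta>\<^sup>2 + 4 * K * \<delta>\<^sup>2 + 4 * K\<^sup>2 * \<delta> ^ 6) \<longlongrightarrow> (cmod c)\<^sup>2 * 0\<^sup>2 + 4 * K * 0\<^sup>2 + 4 * K\<^sup>2 * 0 ^ 6) (at_right (0::real))"
      by (intro tendsto_intros)
    then show "((\<lambda>\<delta>. (cmod c)\<^sup>2 * \<delta>\<^sup>2 + 4 * K * \<delta>\<^sup>2 + 4 * K\<^sup>2 * \<delta> ^ 6) \<longlongrightarrow> 0) (at_right (0::real))" by simp
    have "eventually (\<lambda>\<delta>. \<delta> \<in> {0<..<min \<rho> \<delta>\<^sub>0}) (at_right 0)"
      using \<rho> \<delta>\<^sub>0 by (intro eventually_at_right_real) auto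
    then show "\<forall>\<^sub>F \<delta> in at_right 0. (cmod c)\<^sup>2 * \<rho>\<^sup>2 - 1 / \<rho>\<^sup>2 \<le> (cmod c)\<^sup>2 * \<delta>\<^sup>2 + 4 * K * \<delta>\<^sup>2 + 4 * K\<^sup>2 * \<delta> ^ 6"
      by eventually_elim (use main \<rho> in auto)
  qed simp
  have "(cmod c)\<^sup>2 * 1\<^sup>2 - 1 / 1\<^sup>2 \<le> (0::real)"
  proof (rule tendsto_upperbound)
    show "((\<lambda>\<rho>. (cmod c)\<^sup>2 * \<rho>\<^sup>2 - 1 / \<rho>\<^sup>2) \<longlongrightarrow> (cmod c)\<^sup>2 * 1\<^sup>2 - 1 / 1\<^sup>2) (at_left (1::real))"
      by (intro tendsto_intros) auto
    have "eventually (\<lambda>\<rho>. \<rho> \<in> {0<..<1}) (at_left (1::real))" by (intro eventually_at_left_real) auto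
    then show "\<forall>\<^sub>F \<rho> in at_left 1. (cmod c)\<^sup>2 * \<rho>\<^sup>2 - 1 / \<rho>\<^sup>2 \<le> (0::real)"
      by eventually_elim (use lim in auto)
  qed simp
  then show ?thesis unfolding c_def by (simp add: power2_le_iff_abs_le abs_square_le_1)
qed

text \<open>The area theorem is applied to the reciprocal of the square-root transform of
  \<open>F\<close>, which has the form \<open>m(z^2) / z\<close> with
  \<open>m = sqrt (F'(0) / k)\<close> and \<open>k\<close> the difference quotient at 0. Its
  coefficient is \<open>m'(0) = - F''(0) / (4 F'(0))\<close>.\<close>

theorem Bieberbach_second_coefficient:
  assumes F: "F holomorphic_on ball 0 1" and inj: "inj_on F (ball 0 1)"
  shows "cmod (deriv (deriv F) 0) \<le> 4 * cmod (deriv F 0)"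
proof -
  have d0: "deriv F 0 \<noteq> 0"
    by (rule holomorphic_injective_imp_regular[OF F _ inj]) auto
  define k where "k = (\<lambda>z. if z = 0 then deriv F 0 else (F z - F 0) / (z - 0))"
  have k: "k holomorphic_on ball 0 1"
    by (rule holomorphic_transform[OF pole_theorem_open[OF F open_ball, of 0 "\<lambda>z. F z / z"]])
       (auto simp: k_def diff_divide_distrib)
  have knz: "k z \<noteq> 0" if "z \<in> ball 0 1" for z
    using d0 inj that unfolding k_def inj_on_def by (metis centre_in_ball diff_zero divide_eq_0_iff right_minus_eq zero_less_one)
  obtain l where l: "l holomorphic_on ball 0 1" "\<And>z. z \<in> ball 0 1 \<Longrightarrow> k z / deriv F 0 = exp (l z)"
  proof (rule contractible_imp_holomorphic_log)
    show "(\<lambda>z. k z / deriv F 0) holomorphic_on ball 0 1" by (intro holomorphic_intros k d0)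
    show "contractible (ball (0::complex) 1)" by (simp add: convex_imp_contractible)
  qed (use knz d0 in auto)
  \<comment> \<open>A holomorphic square root of \<open>F'(0) / k\<close>. Only
    \<open>exp (l 0) = 1\<close> is known about \<open>l 0\<close>; subtracting it selects the root
    with \<open>m 0 = 1\<close>.\<close>
  define m where "m = (\<lambda>w. exp ((l 0 - l w) / 2))"
  have k0: "k 0 = deriv F 0" by (simp add: k_def)
  have el0: "exp (l 0) = 1" using l(2)[of 0] k0 d0 by simp
  have m: "m holomorphic_on ball 0 1" unfolding m_def by (intro holomorphic_intros l) simp
  have m0: "m 0 = 1" by (simp add: m_def)
  have m2: "k w * (m w)\<^sup>2 = deriv F 0" if "w \<in> ball 0 1" for w
  proof -
    have "(m w)\<^sup>2 = exp (l 0 - l w)" by (simp add: m_def power2_eq_square flip: exp_add)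
    also have "\<dots> = inverse (exp (l w))" using el0 by (simp add: exp_diff inverse_eq_divide)
    finally show ?thesis using l(2)[OF that] d0 by (simp add: field_simps)
  qed
  have sq: "z\<^sup>2 \<in> ball 0 1" if "z \<in> ball 0 1" for z :: complex
    using that by (simp add: norm_power power_less_one_iff)
  have "cmod (deriv m 0) \<le> 1"
  proof (rule area_theorem[OF m])
    show "m 0 = 1" by (rule m0)
    show "m w \<noteq> 0" for w by (simp add: m_def)
    show "inj_on (\<lambda>z. m (z\<^sup>2) / z) (ball 0 1 - {0})"
    proof (rule inj_onI)
      fix x y assume x: "x \<in> ball 0 1 - {0}" and y: "y \<in> ball 0 1 - {0}" and eq: "m (x\<^sup>2) / x = m (y\<^sup>2) / y"
      have F2: "F (z\<^sup>2) = F 0 + deriv F 0 / (m (z\<^sup>2) / z)\<^sup>2" if "z \<in> ball 0 1 - {0}" for z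
      proof -
        have "F (z\<^sup>2) = F 0 + k (z\<^sup>2) * z\<^sup>2" using that by (simp add: k_def)
        moreover have "k (z\<^sup>2) = deriv F 0 / (m (z\<^sup>2))\<^sup>2" using m2[OF sq, of z] that by (simp add: m_def field_simps)
        ultimately show ?thesis by (simp add: power_divide)
      qed
      have "F (x\<^sup>2) = F (y\<^sup>2)" using F2[OF x] F2[OF y] eq by simp
      then have xy: "x\<^sup>2 = y\<^sup>2" using inj x y sq unfolding inj_on_def by blast
      \<comment> \<open>Equal squares leave \<open>y = x\<close> or \<open>y = - x\<close>. The
        numerators now agree and are nonzero, which excludes the sign change.\<close>
      then have "m (x\<^sup>2) / x = m (x\<^sup>2) / y" using eq by simp
      then show "x = y" using x y by (simp add: m_def)
    qed
  qed
  moreover have "deriv (deriv F) 0 = - 4 * deriv F 0 * deriv m 0"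
  proof -
    have dk: "(k has_field_derivative deriv k z) (at z)" if "z \<in> ball 0 1" for z
      by (rule holomorphic_derivI[OF k open_ball that])
    have dm: "(m has_field_derivative deriv m 0) (at 0)"
      by (rule holomorphic_derivI[OF m open_ball]) simp
    have e: "eventually (\<lambda>z. z \<in> ball 0 1) (nhds (0::complex))" by (rule eventually_nhds_in_open) auto
    have "((\<lambda>w. k w * (m w)\<^sup>2) has_field_derivative deriv k 0 + 2 * deriv F 0 * deriv m 0) (at 0)"
      using dk[of 0] dm m0 by (auto intro!: derivative_eq_intros simp: k0)
    moreover have "((\<lambda>w. k w * (m w)\<^sup>2) has_field_derivative 0) (at 0)"
      by (rule DERIV_cong_ev[THEN iffD2, OF refl _ refl DERIV_const[of "deriv F 0"]])
         (use e in \<open>eventually_elim, use m2 in auto\<close>)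
    ultimately have k': "deriv k 0 = - 2 * deriv F 0 * deriv m 0"
      by (metis DERIV_unique add_eq_0_iff2 minus_mult_left)
    have FD: "deriv F z = k z + z * deriv k z" if "z \<in> ball 0 1" for z
    proof (rule DERIV_imp_deriv, rule DERIV_cong_ev[THEN iffD1, OF refl _ refl])
      show "((\<lambda>z. F 0 + z * k z) has_field_derivative k z + z * deriv k z) (at z)"
        using dk[OF that] by (auto intro!: derivative_eq_intros)
      show "\<forall>\<^sub>F x in nhds z. F 0 + x * k x = F x" by (rule always_eventually) (simp add: k_def)
    qed
    have k2: "(deriv k has_field_derivative deriv (deriv k) 0) (at 0)"
      by (rule holomorphic_derivI[OF holomorphic_deriv[OF k] open_ball]) auto
    have "deriv (deriv F) 0 = deriv (\<lambda>z. k z + z * deriv k z) 0"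
      by (rule deriv_cong_ev[OF _ refl]) (use e in \<open>eventually_elim, use FD in auto\<close>)
    also have "\<dots> = 2 * deriv k 0"
      using dk[of 0] k2 by (auto intro!: DERIV_imp_deriv derivative_eq_intros)
    finally show ?thesis using k' by simp
  qed
  ultimately show ?thesis by (simp add: norm_mult mult_left_le)
qed

section \<open>Shears of convex harmonic maps\<close>

text \<open>Precomposition with the disc automorphism \<phi> that carries 0 to \<open>z\<close>
  preserves univalence and moves the bound from 0 to \<open>z\<close>. The inequality is homogeneous
  in \<open>F\<close>, so it serves for unnormalised shears.\<close>

lemma Koebe_transform_bound:
  fixes F :: "complex \<Rightarrow> complex"
  assumes F: "F holomorphic_on ball 0 1" and inj: "inj_on F (ball 0 1)" and z: "z \<in> ball 0 1"
  shows "cmod ((1 - (cmod z)\<^sup>2) * deriv (deriv F) z - 2 * cnj z * deriv F z) \<le> 4 * cmod (deriv F z)"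
proof -
  define \<phi> where "\<phi> = Moebius_function 0 (- z)"
  have \<phi>_eq: "\<phi> = (\<lambda>\<zeta>. (\<zeta> + z) / (1 + cnj z * \<zeta>))" by (simp add: \<phi>_def Moebius_function_def fun_eq_iff)
  have z': "cmod (- z) < 1" using z by simp
  have hol: "\<phi> holomorphic_on ball 0 1" unfolding \<phi>_def by (rule Moebius_function_holomorphic[OF z'])
  have range: "\<phi> \<zeta> \<in> ball 0 1" if "\<zeta> \<in> ball 0 1" for \<zeta>
    using Moebius_function_norm_lt_1[OF z', of \<zeta> 0] that by (simp add: \<phi>_def)
  have inj\<phi>: "inj_on \<phi> (ball 0 1)"
  proof (rule inj_on_inverseI)
    fix \<zeta> assume "\<zeta> \<in> ball (0::complex) 1"
    then show "Moebius_function 0 z (\<phi> \<zeta>) = \<zeta>"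
      unfolding \<phi>_def using z by (intro Moebius_function_compose) auto
  qed
  define D where "D = 1 - (cmod z)\<^sup>2"
  have D: "D > 0" using z by (simp add: D_def power_less_one_iff)
  have Dc: "complex_of_real D = 1 - z * cnj z" by (simp only: D_def of_real_diff of_real_1 complex_norm_square)
  have nz: "1 + cnj z * \<zeta> \<noteq> 0" if "\<zeta> \<in> ball 0 1" for \<zeta>
  proof
    assume "1 + cnj z * \<zeta> = 0"
    then have "cmod (cnj z * \<zeta>) = 1" by (metis add_eq_0_iff norm_minus_cancel norm_one)
    moreover have "cmod z * cmod \<zeta> \<le> cmod \<zeta>" "cmod \<zeta> < 1"
      using z that by (auto intro!: mult_left_le_one_le)
    ultimately show False by (simp add: norm_mult)
  qed
  have d\<phi>: "(\<phi> has_field_derivative D / (1 + cnj z * \<zeta>)\<^sup>2) (at \<zeta>)" if "\<zeta> \<in> ball 0 1" for \<zeta>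
    unfolding \<phi>_eq Dc using nz[OF that]
    by (auto intro!: derivative_eq_intros simp: power2_eq_square algebra_simps)
  have dG: "((\<lambda>\<zeta>. F (\<phi> \<zeta>)) has_field_derivative deriv F (\<phi> \<zeta>) * (D / (1 + cnj z * \<zeta>)\<^sup>2)) (at \<zeta>)" if "\<zeta> \<in> ball 0 1" for \<zeta>
    by (rule DERIV_chain2[where g = \<phi>, OF holomorphic_derivI[OF F open_ball range[OF that]] d\<phi>[OF that]])
  have dF: "deriv F holomorphic_on ball 0 1" using F by (rule holomorphic_deriv) simp
  have \<phi>0: "\<phi> 0 = z" by (simp add: \<phi>_eq)
  have e: "eventually (\<lambda>z. z \<in> ball 0 1) (nhds (0::complex))" by (rule eventually_nhds_in_open) auto
  have "deriv (deriv (\<lambda>\<zeta>. F (\<phi> \<zeta>))) 0 = deriv (\<lambda>\<zeta>. deriv F (\<phi> \<zeta>) * (D / (1 + cnj z * \<zeta>)\<^sup>2)) 0"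
    by (rule deriv_cong_ev[OF _ refl]) (use e in \<open>eventually_elim, use dG DERIV_imp_deriv in blast\<close>)
  also have "\<dots> = D * (D * deriv (deriv F) z - 2 * cnj z * deriv F z)"
  proof -
    have "((\<lambda>\<zeta>. deriv F (\<phi> \<zeta>)) has_field_derivative deriv (deriv F) (\<phi> 0) * (D / (1 + cnj z * 0)\<^sup>2)) (at 0)"
      by (rule DERIV_chain2[where g = \<phi>, OF holomorphic_derivI[OF dF open_ball range] d\<phi>]) auto
    then have "((\<lambda>\<zeta>. deriv F (\<phi> \<zeta>) * (D / (1 + cnj z * \<zeta>)\<^sup>2)) has_field_derivative
        D * (D * deriv (deriv F) z - 2 * cnj z * deriv F z)) (at 0)"
      by (auto intro!: derivative_eq_intros simp: \<phi>0 algebra_simps)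
    then show ?thesis by (rule DERIV_imp_deriv)
  qed
  finally have d2: "deriv (deriv (\<lambda>\<zeta>. F (\<phi> \<zeta>))) 0 = D * (D * deriv (deriv F) z - 2 * cnj z * deriv F z)" .
  have d1: "deriv (\<lambda>\<zeta>. F (\<phi> \<zeta>)) 0 = D * deriv F z"
    using dG[of 0, THEN DERIV_imp_deriv] by (simp add: \<phi>0)
  have "cmod (deriv (deriv (\<lambda>\<zeta>. F (\<phi> \<zeta>))) 0) \<le> 4 * cmod (deriv (\<lambda>\<zeta>. F (\<phi> \<zeta>)) 0)"
  proof (rule Bieberbach_second_coefficient)
    show "(\<lambda>\<zeta>. F (\<phi> \<zeta>)) holomorphic_on ball 0 1"
      by (rule holomorphic_on_compose_gen[OF hol F, unfolded o_def]) (use range in auto)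
    show "inj_on (\<lambda>\<zeta>. F (\<phi> \<zeta>)) (ball 0 1)"
      using inj inj\<phi> range unfolding inj_on_def by metis
  qed
  then have "D * cmod (D * deriv (deriv F) z - 2 * cnj z * deriv F z) \<le> D * (4 * cmod (deriv F z))"
    unfolding d1 d2 using D by (simp add: norm_mult mult_ac)
  then show ?thesis using D by (simp add: D_def)
qed

text \<open>Multiplied by \<open>z / F'(z)\<close>, the previous bound puts
  \<open>(1 - r^2) z F'' / F'\<close> into the disc with centre \<open>2 r^2\<close> and radius
  \<open>4 r\<close>. Its leftmost point plus \<open>1 - r^2\<close> is the right-hand side.\<close>

lemma Re_convexity_quotient_ge:
  fixes F :: "complex \<Rightarrow> complex"
  assumes F: "F holomorphic_on ball 0 1" and inj: "inj_on F (ball 0 1)" and z: "cmod z = r" "r < 1"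
  shows "(1 - r\<^sup>2) * Re (1 + z * deriv (deriv F) z / deriv F z) \<ge> 1 - 4 * r + r\<^sup>2"
proof -
  have zb: "z \<in> ball 0 1" using z by simp
  have d: "deriv F z \<noteq> 0" by (rule holomorphic_injective_imp_regular[OF F _ inj zb]) auto
  define X where "X = z * deriv (deriv F) z / deriv F z"
  define W where "W = (1 - (cmod z)\<^sup>2) * deriv (deriv F) z - 2 * cnj z * deriv F z"
  have zz: "z * cnj z = of_real (r\<^sup>2)" using z by (metis complex_norm_square)
  have X: "X * deriv F z = z * deriv (deriv F) z" using d by (simp add: X_def)
  have "z * W = (1 - r\<^sup>2) * (z * deriv (deriv F) z) - 2 * (z * cnj z) * deriv F z"
    by (simp add: W_def z algebra_simps)
  also have "\<dots> = ((1 - r\<^sup>2) * X - 2 * of_real (r\<^sup>2)) * deriv F z"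
    unfolding zz X[symmetric] by (simp add: algebra_simps)
  finally have "z * W = ((1 - r\<^sup>2) * X - 2 * of_real (r\<^sup>2)) * deriv F z" .
  moreover have "cmod (z * W) \<le> r * (4 * cmod (deriv F z))"
    unfolding norm_mult z(1) W_def using Koebe_transform_bound[OF F inj zb] z by (intro mult_left_mono) auto
  ultimately have "cmod (((1 - r\<^sup>2) * X - 2 * of_real (r\<^sup>2)) * deriv F z) \<le> r * (4 * cmod (deriv F z))"
    by simp
  then have "cmod ((1 - r\<^sup>2) * X - 2 * of_real (r\<^sup>2)) * cmod (deriv F z) \<le> (4 * r) * cmod (deriv F z)"
    unfolding norm_mult by (simp only: mult_ac)
  then have "cmod ((1 - r\<^sup>2) * X - 2 * of_real (r\<^sup>2)) \<le> 4 * r"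
    by (rule mult_right_le_imp_le) (use d in simp)
  then have ge: "Re ((1 - r\<^sup>2) * X - 2 * of_real (r\<^sup>2)) \<ge> - (4 * r)"
    using abs_Re_le_cmod[of "(1 - r\<^sup>2) * X - 2 * of_real (r\<^sup>2)"] by linarith
  have "(1 - r\<^sup>2) * Re X - 2 * r\<^sup>2 \<ge> - (4 * r)"
  proof -
    have "Re (of_real x * X - of_real y) = x * Re X - y" for x y by simp
    from this[of "1 - r\<^sup>2" "2 * r\<^sup>2"] show ?thesis using ge by simp
  qed
  then show ?thesis by (simp add: X_def algebra_simps)
qed

lemma has_derivative_harmonic:
  assumes "(h has_field_derivative a) (at z)" "(g has_field_derivative b) (at z)"
  shows "((\<lambda>z. h z + cnj (g z)) has_derivative (\<lambda>v. a * v + cnj (b * v))) (at z)"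
  using assms unfolding has_field_derivative_def
  by (intro has_derivative_add bounded_linear.has_derivative[OF bounded_linear_cnj])

text \<open>The shear construction of Clunie and Sheil-Small: along a vertical chord of the convex image,
  the imaginary part of \<open>h + g\<close> is strictly monotone.\<close>

lemma inj_on_shear:
  assumes S: "open S" and h: "h holomorphic_on S" and g: "g holomorphic_on S"
    and sense: "\<And>z. z \<in> S \<Longrightarrow> cmod (deriv g z) < cmod (deriv h z)"
    and inj: "inj_on (\<lambda>z. h z + cnj (g z)) S"
    and conv: "convex ((\<lambda>z. h z + cnj (g z)) ` S)"
  shows "inj_on (\<lambda>z. h z + g z) S"
proof (rule inj_onI, rule ccontr)
  define f where "f = (\<lambda>z. h z + cnj (g z))"
  fix x y assume xy: "x \<in> S" "y \<in> S" "h x + g x = h y + g y" "x \<noteq> y"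
  define \<kappa> where "\<kappa> = Im (f y - f x)"
  \<comment> \<open>\<open>h + cnj g\<close> and \<open>h + g\<close> have the same real part, so a
    coincidence of the shear puts \<open>f x\<close> and \<open>f y\<close> on one vertical
    line.\<close>
  have line: "f y - f x = \<i> * \<kappa>"
    using arg_cong[OF xy(3), of Re] by (simp add: complex_eq_iff f_def \<kappa>_def)
  have "f y \<noteq> f x" using inj xy unfolding f_def inj_on_def by metis
  then have \<kappa>: "\<kappa> \<noteq> 0" using line by auto
  define v where "v = inv_into S f"
  have vf: "v (f z) = z" if "z \<in> S" for z
    using inj that unfolding v_def f_def by (rule inv_into_f_f)
  have fd: "(f has_derivative (\<lambda>v. deriv h z * v + cnj (deriv g z * v))) (at z)" if "z \<in> S" for z
    unfolding f_def by (intro has_derivative_harmonic holomorphic_derivI[OF h S that] holomorphic_derivI[OF g S that])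
  have contf: "continuous_on S f"
    unfolding f_def using h g by (intro continuous_intros holomorphic_on_imp_continuous_on)
  have openf: "open (f ` S)" by (rule invariance_of_domain[OF contf S]) (use inj in \<open>simp add: f_def\<close>)
  have contv: "continuous_on (f ` S) v"
    by (rule continuous_on_inverse_open[OF S contf _ vf]) auto
  define D where "D = (\<lambda>z. (cmod (deriv h z))\<^sup>2 - (cmod (deriv g z))\<^sup>2)"
  have D: "D z > 0" if "z \<in> S" for z
    using sense[OF that] by (simp add: D_def power_strict_mono)
  \<comment> \<open>Inverse of the differential \<open>w \<mapsto> h' w + cnj (g' w)\<close>, with
    determinant \<open>D\<close>.\<close>
  define v' where "v' = (\<lambda>z w. (cnj (deriv h z) * w - cnj (deriv g z) * cnj w) / D z)"
  have vd: "(v has_derivative v' z) (at (f z))" if "z \<in> S" for z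
  proof (rule has_derivative_inverse_dieudonne[OF S openf contf contv vf that fd[OF that]])
    show "bounded_linear (v' z)"
      unfolding linear_conv_bounded_linear[symmetric] v'_def
      by (rule linearI) (simp_all add: algebra_simps add_divide_distrib diff_divide_distrib scaleR_conv_of_real)
    have Dc: "complex_of_real (D z) = deriv h z * cnj (deriv h z) - deriv g z * cnj (deriv g z)"
      by (simp only: D_def of_real_diff complex_norm_square)
    have "v' z (deriv h z * w + cnj (deriv g z * w)) = of_real (D z) * w / of_real (D z)" for w
      unfolding v'_def Dc by (simp add: algebra_simps)
    then show "v' z \<circ> (\<lambda>v. deriv h z * v + cnj (deriv g z * v)) = id"
      using D[OF that] by (simp add: fun_eq_iff)
  qed
  \<comment> \<open>The preimage of the chord, which convexity keeps inside the image. Because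
    \<open>cnj (\<i> \<kappa>) = - \<i> \<kappa>\<close>, its velocity is
    \<open>\<i> \<kappa> cnj (h' + g') / D\<close>. Multiplied by \<open>h' + g'\<close> this is
    purely imaginary with the sign of \<kappa>, which yields the monotonicity.\<close>
  define \<gamma> where "\<gamma> = (\<lambda>t. v (f x + of_real t * (\<i> * \<kappa>)))"
  have on_line: "f x + of_real t * (\<i> * \<kappa>) \<in> f ` S" if "0 \<le> t" "t \<le> 1" for t
  proof -
    have "f x + of_real t * (\<i> * \<kappa>) = (1 - t) *\<^sub>R f x + t *\<^sub>R f y"
      unfolding line[symmetric] by (simp add: scaleR_conv_of_real algebra_simps)
    then show ?thesis using conv xy that unfolding f_def[symmetric] by (auto intro!: convexD)
  qed
  have der: "((\<lambda>t. Im (h (\<gamma> t) + g (\<gamma> t))) has_real_derivative \<kappa> * (cmod (deriv h (\<gamma> t) + deriv g (\<gamma> t)))\<^sup>2 / D (\<gamma> t)) (at t)"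
    and in_S: "\<gamma> t \<in> S" if t: "0 \<le> t" "t \<le> 1" for t
  proof -
    obtain z where z: "z \<in> S" "f x + of_real t * (\<i> * \<kappa>) = f z" using on_line[OF t] by blast
    then have \<gamma>z: "\<gamma> t = z" by (simp add: \<gamma>_def vf)
    then show "\<gamma> t \<in> S" using z by simp
    have "((\<lambda>t. f x + of_real t * (\<i> * \<kappa>)) has_derivative (\<lambda>s. of_real s * (\<i> * \<kappa>))) (at t)"
      by (auto intro!: derivative_eq_intros)
    then have "((\<lambda>t. v (f x + of_real t * (\<i> * \<kappa>))) has_derivative (\<lambda>s. v' z (of_real s * (\<i> * \<kappa>)))) (at t)"
      by (rule has_derivative_compose) (use vd[OF z(1)] z(2) in simp)
    moreover have "v' z (of_real s * (\<i> * \<kappa>)) = s *\<^sub>R (\<i> * \<kappa> * cnj (deriv h z + deriv g z) / D z)" for s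
      by (simp add: v'_def scaleR_conv_of_real algebra_simps add_divide_distrib)
    ultimately have "(\<gamma> has_vector_derivative \<i> * \<kappa> * cnj (deriv h z + deriv g z) / D z) (at t)"
      by (simp add: has_vector_derivative_def \<gamma>_def)
    moreover have "((\<lambda>w. h w + g w) has_field_derivative deriv h z + deriv g z) (at (\<gamma> t))"
      unfolding \<gamma>z by (intro DERIV_add holomorphic_derivI[OF h S z(1)] holomorphic_derivI[OF g S z(1)])
    ultimately have "((\<lambda>w. h w + g w) \<circ> \<gamma> has_vector_derivative \<i> * \<kappa> * cnj (deriv h z + deriv g z) / D z * (deriv h z + deriv g z)) (at t)"
      by (rule field_vector_diff_chain_at)
    also have "\<i> * \<kappa> * cnj (deriv h z + deriv g z) / D z * (deriv h z + deriv g z) =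
        \<i> * of_real (\<kappa> * (cmod (deriv h z + deriv g z))\<^sup>2 / D z)"
      unfolding of_real_mult of_real_divide complex_norm_square by simp
    finally have "((\<lambda>t. Im (((\<lambda>w. h w + g w) \<circ> \<gamma>) t)) has_vector_derivative
        Im (\<i> * of_real (\<kappa> * (cmod (deriv h z + deriv g z))\<^sup>2 / D z))) (at t)"
      by (rule bounded_linear.has_vector_derivative[OF bounded_linear_Im])
    then show "((\<lambda>t. Im (h (\<gamma> t) + g (\<gamma> t))) has_real_derivative \<kappa> * (cmod (deriv h (\<gamma> t) + deriv g (\<gamma> t)))\<^sup>2 / D (\<gamma> t)) (at t)"
      by (simp add: has_real_derivative_iff_has_vector_derivative \<gamma>z)
  qed
  obtain t where t: "0 < t" "t < 1" and
    mvt: "Im (h (\<gamma> 1) + g (\<gamma> 1)) - Im (h (\<gamma> 0) + g (\<gamma> 0)) = (1 - 0) * (\<kappa> * (cmod (deriv h (\<gamma> t) + deriv g (\<gamma> t)))\<^sup>2 / D (\<gamma> t))"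
    using MVT2[of 0 1, OF zero_less_one der] by auto
  have "\<gamma> 0 = x" "\<gamma> 1 = y" using xy vf line[symmetric] by (auto simp: \<gamma>_def)
  then have "\<kappa> * (cmod (deriv h (\<gamma> t) + deriv g (\<gamma> t)))\<^sup>2 / D (\<gamma> t) = 0"
    using mvt xy by simp
  moreover have "\<gamma> t \<in> S" using in_S t by simp
  ultimately have "deriv h (\<gamma> t) = - deriv g (\<gamma> t)" using \<kappa> D[of "\<gamma> t"] by (auto simp: add_eq_0_iff2)
  then show False using sense[OF \<open>\<gamma> t \<in> S\<close>] by simp
qed

text \<open>This is where the normalisation of the class at the origin enters: it makes
  \<open>g' / h'\<close> vanish at 0.\<close>

lemma dilatation_le:
  assumes h: "h holomorphic_on ball 0 1" and g: "g holomorphic_on ball 0 1"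
    and sense: "\<And>z. z \<in> ball 0 1 \<Longrightarrow> cmod (deriv g z) < cmod (deriv h z)"
    and g0: "deriv g 0 = 0" and z: "z \<in> ball 0 1"
  shows "cmod (deriv g z) \<le> cmod z * cmod (deriv h z)"
proof -
  have nz: "deriv h z \<noteq> 0" if "z \<in> ball 0 1" for z using sense[OF that] by auto
  have "cmod (deriv g z / deriv h z) \<le> cmod z"
  proof (rule Schwarz_Lemma(1))
    show "(\<lambda>z. deriv g z / deriv h z) holomorphic_on ball 0 1"
      using g h nz by (intro holomorphic_intros) auto
    show "cmod (deriv g z / deriv h z) < 1" if "cmod z < 1" for z
      using sense[of z] nz[of z] that by (simp add: norm_divide)
  qed (use g0 z in auto)
  then show ?thesis using nz[OF z] by (simp add: norm_divide pos_divide_le_eq mult.commute)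
qed

text \<open>Here \<open>a = e z h'(z)\<close> and \<open>b = cnj e z g'(z)\<close>, so that \<open>a - cnj b\<close> and \<open>a + b\<close> are, up to the
  factor \<open>\<i>\<close>, the tangents of \<open>e f\<close> and of its shear.\<close>

lemma sheared_tangent_ratio:
  fixes a b :: complex and r \<tau> :: real
  assumes ab: "a - cnj b = of_real \<tau>" and \<tau>: "\<tau> > 0" and le: "cmod b \<le> r * cmod a" and r: "0 \<le> r" "r < 1"
  shows "a + b = of_real (Re (a + b))" "Re (a + b) / \<tau> \<ge> (1 - r) / (1 + r)"
proof -
  define s where "s = Re (a + b)"
  have im: "Im b = - Im a" and re: "Re a - Re b = \<tau>"
    using ab by (simp_all add: complex_eq_iff)
  show "a + b = of_real (Re (a + b))" by (simp add: complex_eq_iff im)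
  have "a \<noteq> 0" using le ab \<tau> r by auto
  then have a: "cmod a > 0" by simp
  have "\<tau> \<le> cmod a + cmod b"
    using norm_triangle_ineq4[of a "cnj b"] \<tau> unfolding ab by simp
  also have "\<dots> \<le> (1 + r) * cmod a" using le by (simp add: algebra_simps)
  finally have \<tau>le: "\<tau> \<le> (1 + r) * cmod a" .
  \<comment> \<open>Both \<open>a + b\<close> and \<open>a - cnj b\<close> are real and the
    imaginary parts of \<open>a\<close> and \<open>b\<close> are opposite, so the product collapses.
    Comparing it with \<open>\<tau> \<le> |a| + |b|\<close> gives
    \<open>s \<ge> |a| - |b|\<close>.\<close>
  have "s * \<tau> = (cmod a)\<^sup>2 - (cmod b)\<^sup>2"
    unfolding cmod_power2 s_def im re[symmetric] by (simp add: algebra_simps power2_eq_square)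
  also have "\<dots> = (cmod a - cmod b) * (cmod a + cmod b)" by (simp add: algebra_simps power2_eq_square)
  also have "\<dots> \<ge> (cmod a - cmod b) * \<tau>"
  proof (rule mult_left_mono)
    show "\<tau> \<le> cmod a + cmod b" by fact
    show "0 \<le> cmod a - cmod b" using le r mult_left_le_one_le[of "cmod a" r] by simp
  qed
  finally have "cmod a - cmod b \<le> s" using \<tau> by simp
  moreover have "(1 - r) * cmod a \<le> cmod a - cmod b" using le by (simp add: algebra_simps)
  ultimately have s: "(1 - r) * cmod a \<le> s" by linarith
  have "(1 - r) * \<tau> \<le> (1 - r) * ((1 + r) * cmod a)" using \<tau>le r by (intro mult_left_mono) auto
  also have "\<dots> = (1 + r) * ((1 - r) * cmod a)" by simp
  also have "\<dots> \<le> (1 + r) * s" using s r by (intro mult_left_mono) auto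
  finally show "Re (a + b) / \<tau> \<ge> (1 - r) / (1 + r)"
    unfolding s_def[symmetric] using \<tau> r by (simp add: field_simps)
qed

text \<open>\<open>T\<close> and \<open>T'\<close> are the first two derivatives of \<open>f\<close>
  in the angle at the point \<open>z\<close>, so \<open>Im (T' / T)\<close> is the rate at which the
  tangent turns. The right-hand side arises from \<open>(1 - r) / (1 + r)\<close> times
  \<open>(1 - 4 r + r^2) / (1 - r^2)\<close>.\<close>

lemma curvature_ge:
  fixes h g :: "complex \<Rightarrow> complex"
  assumes h: "h holomorphic_on ball 0 1" and g: "g holomorphic_on ball 0 1"
    and sense: "\<And>z. z \<in> ball 0 1 \<Longrightarrow> cmod (deriv g z) < cmod (deriv h z)"
    and g0: "deriv g 0 = 0"
    and inj: "inj_on (\<lambda>z. h z + cnj (g z)) (ball 0 1)"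
    and conv: "convex ((\<lambda>z. h z + cnj (g z)) ` ball 0 1)"
    and z: "cmod z = r" "0 < r" "r < 1" and pos: "0 \<le> 1 - 4 * r + r\<^sup>2"
  defines "T \<equiv> \<i> * (z * deriv h z - cnj (z * deriv g z))"
    and "T' \<equiv> - (z * deriv h z + z\<^sup>2 * deriv (deriv h) z + cnj (z * deriv g z + z\<^sup>2 * deriv (deriv g) z))"
  shows "T \<noteq> 0" "(1 + r)\<^sup>2 * Im (T' / T) \<ge> 1 - 4 * r + r\<^sup>2"
proof -
  have zb: "z \<in> ball 0 1" using z by simp
  show T0: "T \<noteq> 0"
  proof
    assume "T = 0"
    then have "z * deriv h z = cnj (z * deriv g z)" by (simp add: T_def)
    then have "cmod (z * deriv h z) = cmod (z * deriv g z)" by (metis complex_mod_cnj)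
    then show False using sense[OF zb] z by (auto simp: norm_mult)
  qed
  define \<tau> where "\<tau> = cmod T"
  define e where "e = \<i> * of_real \<tau> / T"
  have \<tau>: "\<tau> > 0" using T0 by (simp add: \<tau>_def)
  have e1: "cmod e = 1" using T0 by (simp add: e_def \<tau>_def norm_divide norm_mult)
  have e0: "e \<noteq> 0" using e1 by auto
  have eT: "e * T = \<i> * of_real \<tau>" using T0 by (simp add: e_def)
  define F where "F = (\<lambda>z. e * h z + cnj e * g z)"
  have F: "F holomorphic_on ball 0 1" unfolding F_def by (intro holomorphic_intros h g)
  have dh: "(h has_field_derivative deriv h w) (at w)" "(g has_field_derivative deriv g w) (at w)" if "w \<in> ball 0 1" for w
    using holomorphic_derivI[OF h open_ball that] holomorphic_derivI[OF g open_ball that] by auto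
  have ddh: "(deriv h has_field_derivative deriv (deriv h) w) (at w)" "(deriv g has_field_derivative deriv (deriv g) w) (at w)" if "w \<in> ball 0 1" for w
    using holomorphic_derivI[OF holomorphic_deriv[OF h open_ball] open_ball that]
      holomorphic_derivI[OF holomorphic_deriv[OF g open_ball] open_ball that] by auto
  have deriv_cmult': "deriv (\<lambda>z. c * k z) w = c * deriv k w" if "k holomorphic_on ball 0 1" "w \<in> ball 0 1" for c w and k :: "complex \<Rightarrow> complex"
    by (rule DERIV_imp_deriv, rule DERIV_cmult, rule holomorphic_derivI[OF that(1) open_ball that(2)])
  have F1: "deriv F w = e * deriv h w + cnj e * deriv g w" if "w \<in> ball 0 1" for w
    unfolding F_def by (rule DERIV_imp_deriv, intro DERIV_add DERIV_cmult dh that)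
  have F2: "deriv (deriv F) z = e * deriv (deriv h) z + cnj e * deriv (deriv g) z"
  proof -
    have ev: "eventually (\<lambda>z. z \<in> ball 0 1) (nhds z)" using zb by (rule eventually_nhds_in_open[OF open_ball])
    then have "deriv (deriv F) z = deriv (\<lambda>w. e * deriv h w + cnj e * deriv g w) z"
      by (intro deriv_cong_ev refl eventually_mono[OF ev] F1)
    also have "\<dots> = e * deriv (deriv h) z + cnj e * deriv (deriv g) z"
      by (rule DERIV_imp_deriv, intro DERIV_add DERIV_cmult ddh zb)
    finally show ?thesis .
  qed
  have rot: "e * h w + cnj (cnj e * g w) = e * (h w + cnj (g w))" for w by (simp add: algebra_simps)
  have injF: "inj_on F (ball 0 1)"
    unfolding F_def
  proof (rule inj_on_shear)
    show "cmod (deriv (\<lambda>z. cnj e * g z) w) < cmod (deriv (\<lambda>z. e * h z) w)" if "w \<in> ball 0 1" for w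
      using sense[OF that] that e1 by (simp add: deriv_cmult' h g norm_mult)
    show "inj_on (\<lambda>z. e * h z + cnj (cnj e * g z)) (ball 0 1)"
      unfolding rot using inj e0 by (auto simp: inj_on_def)
    have "convex ((*) e ` (\<lambda>z. h z + cnj (g z)) ` ball 0 1)"
      by (intro convex_linear_image conv) (simp add: linear_conv_bounded_linear bounded_linear_mult_right)
    then show "convex ((\<lambda>z. e * h z + cnj (cnj e * g z)) ` ball 0 1)"
      unfolding rot by (simp add: image_image)
  qed (auto intro!: holomorphic_intros h g)
  have F0: "deriv F z \<noteq> 0" by (rule holomorphic_injective_imp_regular[OF F _ injF zb]) auto
  define a where "a = e * (z * deriv h z)"
  define b where "b = cnj e * (z * deriv g z)"
  have ab: "a - cnj b = of_real \<tau>"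
  proof -
    have "\<i> * (a - cnj b) = e * T" by (simp add: a_def b_def T_def algebra_simps)
    then show ?thesis using eT by simp
  qed
  have "cmod b \<le> r * cmod a"
    using dilatation_le[OF h g sense g0 zb] z e1
    by (simp add: a_def b_def norm_mult)
  note ratio = sheared_tangent_ratio[OF ab \<tau> this less_imp_le[OF z(2)] z(3)]
  define s where "s = Re (a + b)"
  have zF: "z * deriv F z = of_real s"
    using ratio(1) F1[OF zb] unfolding s_def by (simp add: a_def b_def algebra_simps)
  define Q where "Q = 1 + z * deriv (deriv F) z / deriv F z"
  define P R where "P = e * (z * deriv h z + z\<^sup>2 * deriv (deriv h) z)"
    and "R = cnj e * (z * deriv g z + z\<^sup>2 * deriv (deriv g) z)"
  have "e * T' = - (P + cnj R)"
    by (simp add: T'_def P_def R_def algebra_simps)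
  \<comment> \<open>The real part does not see the conjugation of \<open>R\<close>; here the second
    derivative of the harmonic map turns into that of the analytic shear.\<close>
  then have "Re (e * T') = - Re (P + R)"
    by simp
  also have "P + R = z * deriv F z + z * (z * deriv (deriv F) z)"
    unfolding F1[OF zb] F2 P_def R_def by (simp add: algebra_simps power2_eq_square)
  also have "\<dots> = (z * deriv F z) * Q" unfolding Q_def using F0 by (simp add: field_simps)
  also have "\<dots> = of_real s * Q" by (simp only: zF)
  finally have ReT': "Re (e * T') = - (s * Re Q)" by simp
  have "T' / T = (e * T') / (e * T)" using e0 by simp
  also have "\<dots> = - \<i> * (e * T') / of_real \<tau>" unfolding eT using \<tau> by (simp add: field_simps)
  also have "Im (- \<i> * (e * T') / of_real \<tau>) = - Re (e * T') / \<tau>"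
    by (simp only: Im_divide_of_real mult_minus_left Im_i_times uminus_complex.sel)
  finally have Im: "Im (T' / T) = s / \<tau> * Re Q" unfolding ReT' by simp
  have Qge: "(1 - r\<^sup>2) * Re Q \<ge> 1 - 4 * r + r\<^sup>2"
    unfolding Q_def by (rule Re_convexity_quotient_ge[OF F injF z(1) z(3)])
  have r2: "0 < 1 - r\<^sup>2" using z by (simp add: power_less_one_iff)
  \<comment> \<open>The ratio \<open>s / \<tau>\<close> is bounded from below only, so its bound may
    be inserted only next to a nonnegative factor; this is the purpose of
    \<open>pos\<close>.\<close>
  have Q0: "Re Q \<ge> 0"
    using Qge pos r2 by (meson order_trans zero_le_mult_iff not_le)
  have "1 - 4 * r + r\<^sup>2 \<le> (1 - r\<^sup>2) * Re Q" by (rule Qge)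
  also have "\<dots> = (1 + r)\<^sup>2 * ((1 - r) / (1 + r) * Re Q)" using z by (simp add: field_simps power2_eq_square)
  also have "\<dots> \<le> (1 + r)\<^sup>2 * (s / \<tau> * Re Q)"
    using ratio(2) Q0 unfolding s_def by (intro mult_left_mono mult_right_mono) auto
  finally show "(1 + r)\<^sup>2 * Im (T' / T) \<ge> 1 - 4 * r + r\<^sup>2" unfolding Im .
qed

section \<open>Convex curves\<close>

text \<open>\<open>K\<close> is the intersection of its supporting half-spaces: a segment from the
  interior point \<open>p\<close> to a point \<open>y\<close> outside meets the frontier at some
  \<open>x\<close> before \<open>y\<close>. As \<open>p\<close> lies strictly inside the half-space
  at \<open>x\<close>, the point \<open>y\<close> lies strictly outside it.\<close>

lemma convex_of_supporting_halfspaces: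
  fixes K :: "'a::euclidean_space set"
  assumes K: "closed K" and p: "p \<in> interior K"
    and supp: "\<And>x. x \<in> frontier K \<Longrightarrow> \<exists>a. a \<noteq> 0 \<and> (\<forall>y\<in>K. a \<bullet> x \<le> a \<bullet> y)"
  shows "convex K"
proof -
  obtain A where A: "\<And>x. x \<in> frontier K \<Longrightarrow> A x \<noteq> 0 \<and> (\<forall>y\<in>K. A x \<bullet> x \<le> A x \<bullet> y)"
    using supp by metis
  have "K = (\<Inter>x\<in>frontier K. {y. A x \<bullet> y \<ge> A x \<bullet> x})"
  proof (intro equalityI subsetI)
    fix y assume y: "y \<in> (\<Inter>x\<in>frontier K. {y. A x \<bullet> y \<ge> A x \<bullet> x})"
    show "y \<in> K"
    proof (rule ccontr)
      assume yK: "y \<notin> K"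
      have "closed_segment p y \<inter> frontier K \<noteq> {}"
      proof (rule connected_Int_frontier)
        show "closed_segment p y \<inter> K \<noteq> {}" using p interior_subset by blast
        show "closed_segment p y - K \<noteq> {}" using yK by auto
      qed simp
      then obtain x where x: "x \<in> closed_segment p y" "x \<in> frontier K" by blast
      then obtain u where u: "x = (1 - u) *\<^sub>R p + u *\<^sub>R y" "0 \<le> u" "u \<le> 1" by (auto simp: in_segment)
      have "x \<noteq> y" using x yK K frontier_subset_closed by blast
      then have "u < 1" using u by (cases "u = 1") auto
      have "K \<subseteq> {y. A x \<bullet> y \<ge> A x \<bullet> x}" using A[OF x(2)] by auto
      then have "p \<in> interior {y. A x \<bullet> y \<ge> A x \<bullet> x}" using p interior_mono by blast
      then have "A x \<bullet> p > A x \<bullet> x" using A[OF x(2)] by (simp add: interior_halfspace_ge)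
      then have "(1 - u) * (A x \<bullet> p) > (1 - u) * (A x \<bullet> x)" using \<open>u < 1\<close> by simp
      moreover have "u * (A x \<bullet> y) \<ge> u * (A x \<bullet> x)" using y x u by (intro mult_left_mono) auto
      moreover have "A x \<bullet> x = (1 - u) * (A x \<bullet> p) + u * (A x \<bullet> y)"
        by (subst (2) u(1)) (simp add: inner_add_right)
      ultimately show False by (simp add: algebra_simps)
    qed
  qed (use A frontier_subset_closed[OF K] in auto)
  moreover have "convex (\<Inter>x\<in>frontier K. {y. A x \<bullet> y \<ge> A x \<bullet> x})"
    by (intro convex_INT convex_halfspace_ge)
  ultimately show ?thesis by simp
qed

text \<open>The height \<open>u\<close> over the tangent at the starting point has derivative
  \<open>|T|\<close> times the sine of the angle turned so far. It rises until the tangent has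
  turned by \<open>pi\<close>, then falls, and is back at its initial value after one period, so it
  never drops below that value.\<close>

lemma closed_curve_left_of_tangent:
  fixes c T :: "real \<Rightarrow> complex" and \<phi> :: "real \<Rightarrow> real"
  assumes c: "\<And>\<theta>. (c has_vector_derivative T \<theta>) (at \<theta>)"
    and T: "\<And>\<theta>. T \<theta> = of_real (cmod (T \<theta>)) * cis (\<phi> \<theta>)"
    and \<phi>: "\<And>\<theta>. \<phi> differentiable at \<theta>" "\<And>\<theta>. deriv \<phi> \<theta> > 0"
    and \<phi>_period: "\<And>\<theta>. \<phi> (\<theta> + 2 * pi) = \<phi> \<theta> + 2 * pi"
    and c_period: "c (\<theta>\<^sub>0 + 2 * pi) = c \<theta>\<^sub>0"
    and \<theta>: "\<theta>\<^sub>0 \<le> \<theta>" "\<theta> \<le> \<theta>\<^sub>0 + 2 * pi"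
  shows "Im (cis (- \<phi> \<theta>\<^sub>0) * c \<theta>\<^sub>0) \<le> Im (cis (- \<phi> \<theta>\<^sub>0) * c \<theta>)"
proof -
  define u where "u = (\<lambda>t. Im (cis (- \<phi> \<theta>\<^sub>0) * c t))"
  have d\<phi>: "(\<phi> has_real_derivative deriv \<phi> t) (at t)" for t
    using \<phi>(1) by (simp add: DERIV_deriv_iff_real_differentiable)
  have mono: "\<phi> s \<le> \<phi> t" if "s \<le> t" for s t
    using that by (rule DERIV_nonneg_imp_nondecreasing) (use d\<phi> \<phi>(2) less_imp_le in blast)
  have du: "(u has_real_derivative cmod (T t) * sin (\<phi> t - \<phi> \<theta>\<^sub>0)) (at t)" for t
  proof -
    have "(u has_vector_derivative Im (cis (- \<phi> \<theta>\<^sub>0) * T t)) (at t)"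
      unfolding u_def
      by (intro bounded_linear.has_vector_derivative[OF bounded_linear_Im]
          bounded_linear.has_vector_derivative[OF bounded_linear_mult_right] c)
    also have "cis (- \<phi> \<theta>\<^sub>0) * T t = of_real (cmod (T t)) * cis (\<phi> t - \<phi> \<theta>\<^sub>0)"
      by (subst T) (simp add: cis_mult)
    finally show ?thesis by (simp add: has_real_derivative_iff_has_vector_derivative)
  qed
  have "\<exists>t\<ge>\<theta>\<^sub>0. t \<le> \<theta>\<^sub>0 + 2 * pi \<and> \<phi> t = \<phi> \<theta>\<^sub>0 + pi"
  proof (rule IVT')
    show "continuous_on {\<theta>\<^sub>0..\<theta>\<^sub>0 + 2 * pi} \<phi>"
      using d\<phi> DERIV_isCont by (intro continuous_at_imp_continuous_on) blast
  qed (auto simp: \<phi>_period)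
  then obtain t where t: "\<theta>\<^sub>0 \<le> t" "t \<le> \<theta>\<^sub>0 + 2 * pi" "\<phi> t = \<phi> \<theta>\<^sub>0 + pi" by blast
  have "u \<theta>\<^sub>0 \<le> u \<theta>"
  proof (cases "\<theta> \<le> t")
    case True
    show ?thesis
    proof (rule DERIV_nonneg_imp_nondecreasing[OF \<theta>(1)])
      fix x assume "\<theta>\<^sub>0 \<le> x" "x \<le> \<theta>"
      then have "\<phi> \<theta>\<^sub>0 \<le> \<phi> x" "\<phi> x \<le> \<phi> t" using True by (auto intro!: mono)
      then have "0 \<le> cmod (T x) * sin (\<phi> x - \<phi> \<theta>\<^sub>0)" using t(3) by (intro mult_nonneg_nonneg sin_ge_zero) auto
      then show "\<exists>y. (u has_real_derivative y) (at x) \<and> 0 \<le> y" using du by blast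
    qed
  next
    case False
    have "u (\<theta>\<^sub>0 + 2 * pi) \<le> u \<theta>"
    proof (rule DERIV_nonpos_imp_nonincreasing[OF \<theta>(2)])
      fix x assume "\<theta> \<le> x" "x \<le> \<theta>\<^sub>0 + 2 * pi"
      then have "\<phi> t \<le> \<phi> x" "\<phi> x \<le> \<phi> (\<theta>\<^sub>0 + 2 * pi)" using False by (auto intro!: mono)
      then have "0 \<le> sin (\<phi> x - \<phi> \<theta>\<^sub>0 - pi)" using t(3) by (intro sin_ge_zero) (auto simp: \<phi>_period)
      then have "cmod (T x) * sin (\<phi> x - \<phi> \<theta>\<^sub>0) \<le> 0" by (intro mult_nonneg_nonpos) (auto simp: sin_diff)
      then show "\<exists>y. (u has_real_derivative y) (at x) \<and> y \<le> 0" using du by blast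
    qed
    then show ?thesis by (simp add: u_def c_period)
  qed
  then show ?thesis by (simp add: u_def)
qed

text \<open>The convex body is the image \<open>K\<close> of the closed disc. Invariance of domain
  puts the image of the open disc into the interior, so the frontier lies on the curve. A linear
  functional attains its minimum over \<open>K\<close> on the frontier, hence support along the
  curve is support of all of \<open>K\<close>; and a supported point is not interior, so the whole
  curve is frontier.\<close>

lemma convex_curve_image_sphere:
  fixes f :: "complex \<Rightarrow> complex"
  assumes r: "r > 0" and cont: "continuous_on (cball 0 r) f" and inj: "inj_on f (cball 0 r)"
    and supp: "\<And>z. z \<in> sphere 0 r \<Longrightarrow> \<exists>a. a \<noteq> 0 \<and> (\<forall>w\<in>sphere 0 r. a \<bullet> f z \<le> a \<bullet> f w)"
  shows "convex_curve (f ` sphere 0 r)"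
proof -
  define K where "K = f ` cball 0 r"
  have K: "compact K" unfolding K_def by (intro compact_continuous_image cont) simp
  have "open (f ` ball 0 r)" by (rule invariance_of_domain_ball[OF cont r inj])
  then have int: "f ` ball 0 r \<subseteq> interior K"
    unfolding K_def by (intro interior_maximal image_mono) auto
  have fr: "frontier K \<subseteq> f ` sphere 0 r"
  proof
    fix y assume "y \<in> frontier K"
    then have "y \<in> K" "y \<notin> interior K" using K by (auto simp: frontier_def compact_imp_closed)
    then obtain z where z: "z \<in> cball 0 r" "y = f z" "z \<notin> ball 0 r" using int unfolding K_def by blast
    then show "y \<in> f ` sphere 0 r" by auto
  qed
  have touch: "x \<notin> interior K" if a: "a \<noteq> 0" "\<And>y. y \<in> K \<Longrightarrow> a \<bullet> x \<le> a \<bullet> y" for a x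
  proof
    assume "x \<in> interior K"
    moreover have "K \<subseteq> {y. a \<bullet> y \<ge> a \<bullet> x}" using a(2) by auto
    ultimately have "x \<in> interior {y. a \<bullet> y \<ge> a \<bullet> x}" using interior_mono by blast
    then show False using a(1) by (simp add: interior_halfspace_ge)
  qed
  have supp': "\<exists>a. a \<noteq> 0 \<and> (\<forall>y\<in>K. a \<bullet> f z \<le> a \<bullet> y)" if z: "z \<in> sphere 0 r" for z
  proof -
    obtain a where a: "a \<noteq> 0" "\<And>w. w \<in> sphere 0 r \<Longrightarrow> a \<bullet> f z \<le> a \<bullet> f w" using supp[OF z] by blast
    have "K \<noteq> {}" unfolding K_def using r by auto
    moreover have "continuous_on K (\<lambda>w. a \<bullet> w)" by (intro continuous_intros)
    ultimately obtain y where y: "y \<in> K" "\<And>w. w \<in> K \<Longrightarrow> a \<bullet> y \<le> a \<bullet> w"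
      using continuous_attains_inf[OF K] by blast
    then have "y \<in> frontier K" using touch[OF a(1), of y] K by (auto simp: frontier_def compact_imp_closed)
    then obtain w where "w \<in> sphere 0 r" "y = f w" using fr by blast
    then have "a \<bullet> f z \<le> a \<bullet> y" using a(2) by simp
    then show ?thesis using y(2) a(1) by (meson order_trans)
  qed
  have fr_eq: "f ` sphere 0 r = frontier K"
  proof (rule antisym[OF _ fr])
    have "f z \<in> frontier K" if z: "z \<in> sphere 0 r" for z
    proof -
      have "f z \<notin> interior K" using supp'[OF z] touch by blast
      moreover have "f z \<in> K" using z by (auto simp: K_def)
      ultimately show ?thesis using K by (auto simp: frontier_def compact_imp_closed)
    qed
    then show "f ` sphere 0 r \<subseteq> frontier K" by blast
  qed
  have "f 0 \<in> interior K" using int r by auto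
  moreover have "convex K"
    by (rule convex_of_supporting_halfspaces[OF compact_imp_closed[OF K] \<open>f 0 \<in> interior K\<close>]) (use fr supp' in blast)
  ultimately show ?thesis unfolding convex_curve_def using K fr_eq by blast
qed

text \<open>\<open>T cis (- \<phi>)\<close> is the real number \<open>|T|\<close>, so the derivative
  of its imaginary part vanishes; solving for the derivative of \<phi> avoids differentiating
  \<open>|T|\<close>.\<close>

lemma deriv_argument:
  assumes T: "\<And>t. T t = of_real (cmod (T t)) * cis (\<phi> t)" and T0: "T \<theta> \<noteq> 0"
    and T': "(T has_vector_derivative T') (at \<theta>)" and \<phi>: "\<phi> differentiable at \<theta>"
  shows "deriv \<phi> \<theta> = Im (T' / T \<theta>)"
proof -
  have "(\<phi> has_real_derivative deriv \<phi> \<theta>) (at \<theta>)"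
    using \<phi> by (simp add: DERIV_deriv_iff_real_differentiable)
  then have "((\<lambda>t. cis (- \<phi> t)) has_vector_derivative (- deriv \<phi> \<theta>) *\<^sub>R (\<i> * cis (- \<phi> \<theta>))) (at \<theta>)"
    unfolding has_vector_derivative_def has_field_derivative_def
    by (auto intro!: derivative_eq_intros)
  from has_vector_derivative_mult[OF T' this]
  have "((\<lambda>t. Im (T t * cis (- \<phi> t))) has_vector_derivative
          Im (T \<theta> * ((- deriv \<phi> \<theta>) *\<^sub>R (\<i> * cis (- \<phi> \<theta>))) + T' * cis (- \<phi> \<theta>))) (at \<theta>)"
    by (rule bounded_linear.has_vector_derivative[OF bounded_linear_Im])
  moreover have *: "T t * cis (- \<phi> t) = of_real (cmod (T t))" for t
    by (subst T) (simp add: cis_mult mult.assoc)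
  then have "(\<lambda>t. Im (T t * cis (- \<phi> t))) = (\<lambda>_. 0)" by simp
  ultimately have 0: "Im (T \<theta> * ((- deriv \<phi> \<theta>) *\<^sub>R (\<i> * cis (- \<phi> \<theta>))) + T' * cis (- \<phi> \<theta>)) = 0"
    by (metis has_vector_derivative_const vector_derivative_unique_at)
  then have "Im (T' * cis (- \<phi> \<theta>)) = deriv \<phi> \<theta> * cmod (T \<theta>)"
    using arg_cong[OF *[of \<theta>], of Re] by simp
  moreover have "T' / T \<theta> = (T' * cis (- \<phi> \<theta>)) / of_real (cmod (T \<theta>))"
    unfolding *[symmetric] by simp
  ultimately show ?thesis using T0 by (simp add: Im_divide_of_real)
qed

section \<open>The radius of full convexity\<close>

text \<open>On the unit interval the polynomial decreases strictly from \<open>1 - \<alpha>\<close>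
  to \<open>-6\<close>. The second conclusion is the form in which the root enters the curvature
  estimate.\<close>

lemma radius_polynomial_root:
  fixes \<alpha> :: real
  assumes \<alpha>: "0 \<le> \<alpha>" "\<alpha> < 1"
  obtains rC where "{r. 0 < r \<and> r < 1 \<and> 2 * (1 - \<alpha>) * (1 - r) ^ 4 + \<alpha> * (1 - r) ^ 2 - (r ^ 2 + 4 * r + 1) = 0} = {rC}"
    "\<And>r. 0 < r \<Longrightarrow> r < rC \<Longrightarrow> r < 1 \<and> 6 * r < 1 - \<alpha>"
proof -
  define P where "P = (\<lambda>r::real. 2 * (1 - \<alpha>) * (1 - r) ^ 4 + \<alpha> * (1 - r) ^ 2 - (r ^ 2 + 4 * r + 1))"
  have decr: "P y < P x" if "0 \<le> x" "x < y" "y \<le> 1" for x y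
  proof -
    have "(1 - y) ^ 4 \<le> (1 - x) ^ 4" "(1 - y) ^ 2 \<le> (1 - x) ^ 2" "x ^ 2 \<le> y ^ 2"
      using that by (auto intro!: power_mono)
    then have "2 * (1 - \<alpha>) * (1 - y) ^ 4 \<le> 2 * (1 - \<alpha>) * (1 - x) ^ 4" "\<alpha> * (1 - y) ^ 2 \<le> \<alpha> * (1 - x) ^ 2"
      using \<alpha> by (auto intro!: mult_left_mono)
    then show ?thesis unfolding P_def using \<open>x ^ 2 \<le> y ^ 2\<close> that(2) by linarith
  qed
  have P0: "P 0 = 1 - \<alpha>" and P1: "P 1 = - 6" by (simp_all add: P_def)
  have "\<exists>r\<ge>0. r \<le> 1 \<and> P r = 0"
    by (rule IVT2') (use \<alpha> P0 P1 in \<open>auto simp: P_def intro!: continuous_intros\<close>)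
  then obtain rC where rC: "0 \<le> rC" "rC \<le> 1" "P rC = 0" by blast
  have rC': "0 < rC" "rC < 1" using rC P0 P1 \<alpha> by (auto simp: order_less_le)
  have uniq: "r = rC" if "0 < r" "r < 1" "P r = 0" for r
    using decr[of r rC] decr[of rC r] that rC rC' by (cases r rC rule: linorder_cases) auto
  show ?thesis
  proof (rule that[of rC])
    show "{r. 0 < r \<and> r < 1 \<and> 2 * (1 - \<alpha>) * (1 - r) ^ 4 + \<alpha> * (1 - r) ^ 2 - (r ^ 2 + 4 * r + 1) = 0} = {rC}"
    proof -
      have "{r. 0 < r \<and> r < 1 \<and> P r = 0} = {rC}" using uniq rC(3) rC' by blast
      then show ?thesis unfolding P_def .
    qed
    fix r assume r: "0 < r" "r < rC"
    then have r1: "r < 1" using rC' by simp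
    have "P r > 0" using decr[of r rC] r rC by simp
    \<comment> \<open>Obtained from \<open>r^2 + 4 r + 1 = (1 - r)^2 + 6 r\<close>.\<close>
    moreover have "P r = (1 - \<alpha>) * ((1 - r)\<^sup>2 * (2 * (1 - r)\<^sup>2 - 1)) - 6 * r"
      unfolding P_def by (simp add: algebra_simps power2_eq_square power4_eq_xxxx)
    moreover have "(1 - r)\<^sup>2 * (2 * (1 - r)\<^sup>2 - 1) \<le> 1"
    proof -
      have "(1 - r)\<^sup>2 \<le> 1" using r r1 by (simp add: power_le_one)
      then have "(1 - r)\<^sup>2 * (2 * (1 - r)\<^sup>2 - 1) \<le> (1 - r)\<^sup>2 * 1" by (intro mult_left_mono) auto
      then show ?thesis using \<open>(1 - r)\<^sup>2 \<le> 1\<close> by linarith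
    qed
    then have "(1 - \<alpha>) * ((1 - r)\<^sup>2 * (2 * (1 - r)\<^sup>2 - 1)) \<le> (1 - \<alpha>) * 1"
      using \<alpha> by (intro mult_left_mono) auto
    ultimately show "r < 1 \<and> 6 * r < 1 - \<alpha>" using r1 by simp
  qed
qed

lemma deriv_zbar_harmonic:
  assumes "(h has_field_derivative a) (at z)" "(g has_field_derivative b) (at z)"
    and "open S" "z \<in> S" "\<And>w. w \<in> S \<Longrightarrow> f w = h w + cnj (g w)"
  shows "deriv_zbar f z = cnj b"
proof -
  have "(f has_derivative (\<lambda>v. a * v + cnj (b * v))) (at z)"
    by (rule has_derivative_transform_within_open[OF has_derivative_harmonic[OF assms(1,2)] assms(3,4)])
       (simp add: assms(5))
  then have "frechet_derivative f (at z) = (\<lambda>v. a * v + cnj (b * v))"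
    by (rule frechet_derivative_at[symmetric])
  then show ?thesis by (simp add: deriv_zbar_def algebra_simps)
qed

theorem fully_convex_on_circle:
  fixes f h g :: "complex \<Rightarrow> complex"
  assumes h: "h holomorphic_on ball 0 1" and g: "g holomorphic_on ball 0 1"
    and f: "\<And>z. z \<in> ball 0 1 \<Longrightarrow> f z = h z + cnj (g z)"
    and sense: "\<And>z. z \<in> ball 0 1 \<Longrightarrow> cmod (deriv g z) < cmod (deriv h z)"
    and g0: "deriv g 0 = 0"
    and inj: "inj_on f (ball 0 1)" and conv: "convex (f ` ball 0 1)"
    and \<alpha>: "0 \<le> \<alpha>" and r: "0 < r" "6 * r < 1 - \<alpha>"
  shows "convex_curve (f ` sphere 0 r)"
    "\<exists>(T :: real \<Rightarrow> complex) (\<phi> :: real \<Rightarrow> real).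
           (\<forall>\<theta>. ((\<lambda>t. f (of_real r * cis t)) has_vector_derivative T \<theta>) (at \<theta>) \<and>
                T \<theta> \<noteq> 0 \<and> T \<theta> = of_real (norm (T \<theta>)) * cis (\<phi> \<theta>)) \<and>
           (\<forall>\<theta>. \<phi> differentiable at \<theta>) \<and>
           (\<forall>\<theta>\<in>{0..2 * pi}. deriv \<phi> \<theta> > \<alpha>)"
proof -
  have r1: "6 * r < 1" using r \<alpha> by simp
  \<comment> \<open>\<open>f\<close> is given by \<open>h\<close> and \<open>g\<close> on the disc
    only, while the estimates above are stated for the formula itself.\<close>
  define f' where "f' = (\<lambda>z. h z + cnj (g z))"
  have ff: "f z = f' z" if "z \<in> ball 0 1" for z using f[OF that] by (simp add: f'_def)
  have inj': "inj_on f' (ball 0 1)" using inj by (simp add: inj_on_def ff)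
  have conv': "convex (f' ` ball 0 1)" using conv by (simp add: image_def ff)
  define Z where "Z = (\<lambda>t. of_real r * cis t)"
  have Zn: "cmod (Z t) = r" for t using r by (simp add: Z_def norm_mult)
  then have Zb: "Z t \<in> ball 0 1" for t using r1 r by simp
  have Z0: "Z t \<noteq> 0" for t using Zn[of t] r by auto
  have Zd: "(Z has_vector_derivative \<i> * Z t) (at t)" for t
  proof -
    have "(Z has_vector_derivative of_real r * (\<i> * cis t)) (at t)"
      unfolding Z_def has_vector_derivative_def by (auto intro!: derivative_eq_intros)
    then show ?thesis by (simp add: Z_def mult_ac)
  qed
  have chain: "((\<lambda>t. k (Z t)) has_vector_derivative \<i> * Z t * D) (at t)"
    if "(k has_field_derivative D) (at (Z t))" for k D t
    using field_vector_diff_chain_at[OF Zd that] by (simp add: o_def)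
  have dh: "(h has_field_derivative deriv h z) (at z)" "(g has_field_derivative deriv g z) (at z)" if "z \<in> ball 0 1" for z
    using holomorphic_derivI[OF h open_ball that] holomorphic_derivI[OF g open_ball that] by auto
  have h1: "deriv h holomorphic_on ball 0 1" "deriv g holomorphic_on ball 0 1"
    using holomorphic_deriv[OF h open_ball] holomorphic_deriv[OF g open_ball] by auto
  have ddh: "(deriv h has_field_derivative deriv (deriv h) z) (at z)" "(deriv g has_field_derivative deriv (deriv g) z) (at z)" if "z \<in> ball 0 1" for z
    using holomorphic_derivI[OF h1(1) open_ball that] holomorphic_derivI[OF h1(2) open_ball that] by auto
  have nz: "deriv h z \<noteq> 0" if "z \<in> ball 0 1" for z using sense[OF that] by auto
  have cnjI: "((\<lambda>t. cnj (u t)) has_vector_derivative cnj D) (at t)" if "(u has_vector_derivative D) (at t)" for u D and t :: real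
    using that by (rule bounded_linear.has_vector_derivative[OF bounded_linear_cnj])
  define T where "T = (\<lambda>t. \<i> * (Z t * deriv h (Z t) - cnj (Z t * deriv g (Z t))))"
  define T' where "T' = (\<lambda>t. - (Z t * deriv h (Z t) + (Z t)\<^sup>2 * deriv (deriv h) (Z t)
    + cnj (Z t * deriv g (Z t) + (Z t)\<^sup>2 * deriv (deriv g) (Z t))))"
  have Td: "((\<lambda>t. f (Z t)) has_vector_derivative T t) (at t)" for t
  proof -
    have "((\<lambda>t. h (Z t) + cnj (g (Z t))) has_vector_derivative \<i> * Z t * deriv h (Z t) + cnj (\<i> * Z t * deriv g (Z t))) (at t)"
      by (intro has_vector_derivative_add cnjI chain dh Zb)
    moreover have "(\<lambda>t. h (Z t) + cnj (g (Z t))) = (\<lambda>t. f (Z t))" using f[OF Zb] by simp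
    ultimately show ?thesis by (simp add: T_def algebra_simps)
  qed
  have Td': "(T has_vector_derivative T' t) (at t)" for t
  proof -
    have d1: "((\<lambda>z. z * deriv h z) has_field_derivative deriv h (Z t) + Z t * deriv (deriv h) (Z t)) (at (Z t))"
      using ddh(1)[OF Zb[of t]] by (auto intro!: derivative_eq_intros)
    have d2: "((\<lambda>z. z * deriv g z) has_field_derivative deriv g (Z t) + Z t * deriv (deriv g) (Z t)) (at (Z t))"
      using ddh(2)[OF Zb[of t]] by (auto intro!: derivative_eq_intros)
    have "(T has_vector_derivative \<i> * (\<i> * Z t * (deriv h (Z t) + Z t * deriv (deriv h) (Z t)) -
        cnj (\<i> * Z t * (deriv g (Z t) + Z t * deriv (deriv g) (Z t))))) (at t)"
      unfolding T_def
      by (intro bounded_linear.has_vector_derivative[OF bounded_linear_mult_right] has_vector_derivative_diff cnjI chain[OF d1] chain[OF d2])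
    then show ?thesis by (simp add: T'_def algebra_simps power2_eq_square)
  qed
  have pos: "0 \<le> 1 - 4 * r + r\<^sup>2" using zero_le_power2[of r] r1 r by linarith
  have rlt: "r < 1" using r1 r by simp
  note curv = curvature_ge[OF h g sense g0 inj'[unfolded f'_def] conv'[unfolded f'_def] Zn r(1) rlt pos]
  have T0: "T t \<noteq> 0" for t using curv(1)[of t] by (simp add: T_def)
  have curvature: "Im (T' t / T t) > \<alpha>" for t
  proof -
    have "(1 + r)\<^sup>2 * Im (T' t / T t) \<ge> 1 - 4 * r + r\<^sup>2" using curv(2)[of t] unfolding T_def T'_def by simp
    moreover have "(1 + r)\<^sup>2 * \<alpha> < (1 + r)\<^sup>2 * (1 - 6 * r)" using r by simp
    moreover have "(1 + r)\<^sup>2 * (1 - 6 * r) \<le> 1 - 4 * r + r\<^sup>2"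
    proof -
      have "1 - 4 * r + r\<^sup>2 - (1 + r)\<^sup>2 * (1 - 6 * r) = 12 * r\<^sup>2 + 6 * r ^ 3"
        by (simp add: algebra_simps power2_eq_square power3_eq_cube)
      moreover have "\<dots> \<ge> 0" using r by simp
      ultimately show ?thesis by linarith
    qed
    ultimately have "(1 + r)\<^sup>2 * \<alpha> < (1 + r)\<^sup>2 * Im (T' t / T t)" by linarith
    then show ?thesis using r by simp
  qed
  obtain l where l: "l holomorphic_on ball 0 1" "\<And>z. z \<in> ball 0 1 \<Longrightarrow> deriv h z = exp (l z)"
    by (rule contractible_imp_holomorphic_log[OF h1(1)]) (use nz in \<open>auto simp: convex_imp_contractible\<close>)
  \<comment> \<open>\<open>T = \<i> Z h'(Z) C\<close>. The analytic factor \<open>h'\<close> has a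
    logarithm on the whole disc, and \<open>C\<close> stays in the right half-plane because
    \<open>|g'| < |h'|\<close>, so the principal logarithm of \<open>C\<close> is smooth.\<close>
  define C where "C = (\<lambda>t. 1 - cnj (Z t * deriv g (Z t)) * (1 / (Z t * deriv h (Z t))))"
  have C_pos: "Re (C t) > 0" for t
  proof -
    have "cmod (cnj (Z t * deriv g (Z t)) * (1 / (Z t * deriv h (Z t)))) < 1"
      using sense[OF Zb[of t]] nz[OF Zb[of t]] Z0[of t] by (simp add: norm_mult norm_divide)
    then show ?thesis using complex_Re_le_cmod[of "cnj (Z t * deriv g (Z t)) * (1 / (Z t * deriv h (Z t)))"]
      by (simp add: C_def)
  qed
  \<comment> \<open>The sum of the arguments of the factors \<open>\<i>\<close>, \<open>Z t\<close>,
    \<open>h'\<close> and \<open>C\<close>. All summands except \<open>t\<close> are constant or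
    have period \<open>2 * pi\<close>, so the total turning is exactly
    \<open>2 * pi\<close>.\<close>
  define \<phi> where "\<phi> = (\<lambda>t. pi / 2 + t + Im (l (Z t)) + Im (Ln (C t)))"
  have polar: "T t = of_real (cmod (T t)) * cis (\<phi> t)" for t
  proof -
    have "T t = \<i> * Z t * deriv h (Z t) * C t"
      using nz[OF Zb[of t]] Z0[of t] by (simp add: T_def C_def field_simps)
    also have "\<dots> = \<i> * (of_real (exp (ln r)) * cis t) * exp (l (Z t)) * exp (Ln (C t))"
    proof -
      have "C t \<noteq> 0" using C_pos[of t] by auto
      then show ?thesis using l(2)[OF Zb[of t]] r by (simp add: Z_def)
    qed
    also have "\<dots> = exp (of_real (ln r) + \<i> * of_real (pi / 2) + \<i> * of_real t + l (Z t) + Ln (C t))"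
      by (simp only: exp_add cis_conv_exp[symmetric] exp_of_real cis_pi_half mult_ac)
    finally have E: "T t = exp (of_real (ln r) + \<i> * of_real (pi / 2) + \<i> * of_real t + l (Z t) + Ln (C t))" .
    have "T t = of_real (exp (Re (of_real (ln r) + \<i> * of_real (pi / 2) + \<i> * of_real t + l (Z t) + Ln (C t)))) * cis (\<phi> t)"
      unfolding E exp_eq_polar by (simp add: \<phi>_def)
    then show ?thesis unfolding E norm_exp_eq_Re by simp
  qed
  have \<phi>d: "\<phi> differentiable at t" for t
  proof -
    have "((\<lambda>t. Im (l (Z t))) has_vector_derivative Im (\<i> * Z t * deriv l (Z t))) (at t)"
      by (intro bounded_linear.has_vector_derivative[OF bounded_linear_Im] chain holomorphic_derivI[OF l(1) open_ball Zb])
    then have 1: "(\<lambda>t. Im (l (Z t))) differentiable at t" by (rule differentiableI_vector)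
    have "(\<lambda>z. z * deriv g z) holomorphic_on ball 0 1 - {0}" "(\<lambda>z. 1 / (z * deriv h z)) holomorphic_on ball 0 1 - {0}"
      using nz by (auto intro!: holomorphic_intros holomorphic_on_subset[OF h1(1)] holomorphic_on_subset[OF h1(2)])
    moreover have "open (ball 0 1 - {0::complex})" "Z t \<in> ball 0 1 - {0}" using Zb[of t] Z0 by auto
    ultimately obtain D1 D2 where D: "((\<lambda>z. z * deriv g z) has_field_derivative D1) (at (Z t))"
        "((\<lambda>z. 1 / (z * deriv h z)) has_field_derivative D2) (at (Z t))"
      using holomorphic_derivI by metis
    obtain DC where DC: "(C has_vector_derivative DC) (at t)"
      unfolding C_def using has_vector_derivative_diff[OF has_vector_derivative_const has_vector_derivative_mult[OF cnjI[OF chain[OF D(1)]] chain[OF D(2)]]] by blast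
    have "C t \<notin> \<real>\<^sub>\<le>\<^sub>0" using C_pos[of t] by (auto elim!: nonpos_Reals_cases)
    then have "(Ln has_field_derivative inverse (C t)) (at (C t))" by (rule has_field_derivative_Ln)
    from field_vector_diff_chain_at[OF DC this]
    have "((\<lambda>t. Im ((Ln \<circ> C) t)) has_vector_derivative Im (DC * inverse (C t))) (at t)"
      by (rule bounded_linear.has_vector_derivative[OF bounded_linear_Im])
    then have 2: "(\<lambda>t. Im (Ln (C t))) differentiable at t" by (auto intro: differentiableI_vector)
    show ?thesis unfolding \<phi>_def by (intro differentiable_add 1 2 differentiable_const differentiable_ident)
  qed
  have deriv: "deriv \<phi> t > \<alpha>" for t
    using curvature[of t] deriv_argument[OF polar T0 Td' \<phi>d] by simp
  have Zper: "Z (t + 2 * pi) = Z t" for t by (simp add: Z_def cis.code)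
  have \<phi>per: "\<phi> (t + 2 * pi) = \<phi> t + 2 * pi" for t by (simp add: \<phi>_def C_def Zper)
  show "\<exists>(T :: real \<Rightarrow> complex) (\<phi> :: real \<Rightarrow> real).
           (\<forall>\<theta>. ((\<lambda>t. f (of_real r * cis t)) has_vector_derivative T \<theta>) (at \<theta>) \<and>
                T \<theta> \<noteq> 0 \<and> T \<theta> = of_real (norm (T \<theta>)) * cis (\<phi> \<theta>)) \<and>
           (\<forall>\<theta>. \<phi> differentiable at \<theta>) \<and>
           (\<forall>\<theta>\<in>{0..2 * pi}. deriv \<phi> \<theta> > \<alpha>)"
    using Td T0 polar \<phi>d deriv unfolding Z_def by blast
  show "convex_curve (f ` sphere 0 r)"
  proof (rule convex_curve_image_sphere[OF r(1)])
    have sub: "cball 0 r \<subseteq> ball (0::complex) 1" using rlt by auto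
    have "continuous_on (ball 0 1) f'"
      unfolding f'_def using h g by (intro continuous_intros holomorphic_on_imp_continuous_on)
    then have "continuous_on (ball 0 1) f" by (rule continuous_on_eq) (simp add: ff)
    then show "continuous_on (cball 0 r) f" by (rule continuous_on_subset) (rule sub)
    show "inj_on f (cball 0 r)" by (rule inj_on_subset[OF inj sub])
    \<comment> \<open>The parameter interval starts at the point of tangency, as the comparison with
      the tangent there requires.\<close>
    have onto: "\<exists>t\<ge>t\<^sub>0. t \<le> t\<^sub>0 + 2 * pi \<and> w = Z t" if "w \<in> sphere 0 r" for w t\<^sub>0
    proof -
      have w: "cmod (w * cis (- t\<^sub>0)) = r" using that by (simp add: norm_mult)
      define s where "s = Arg2pi (w * cis (- t\<^sub>0))"
      have "0 \<le> s" "s < 2 * pi" unfolding s_def by (rule Arg2pi_ge_0, rule Arg2pi_lt_2pi)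
      have "w * cis (- t\<^sub>0) = of_real r * exp (\<i> * of_real s)"
        using Arg2pi_eq[of "w * cis (- t\<^sub>0)"] unfolding s_def w by simp
      then have "w * cis (- t\<^sub>0) * cis t\<^sub>0 = of_real r * cis s * cis t\<^sub>0" by (simp add: cis_conv_exp)
      then have "w = Z (t\<^sub>0 + s)" by (simp add: Z_def cis_mult mult.assoc add.commute)
      then show ?thesis using \<open>0 \<le> s\<close> \<open>s < 2 * pi\<close> by (intro exI[of _ "t\<^sub>0 + s"]) auto
    qed
    fix z assume "z \<in> sphere (0::complex) r"
    then obtain t\<^sub>0 where t0: "z = Z t\<^sub>0" using onto by blast
    show "\<exists>a. a \<noteq> 0 \<and> (\<forall>w\<in>sphere 0 r. a \<bullet> f z \<le> a \<bullet> f w)"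
    \<comment> \<open>The witness is the left normal: the inner product with it is the height over
      the tangent at \<open>Z t\<^sub>0\<close>.\<close>
    proof (intro exI[of _ "\<i> * cis (\<phi> t\<^sub>0)"] conjI ballI)
      have inner: "(\<i> * cis (\<phi> t\<^sub>0)) \<bullet> w = Im (cis (- \<phi> t\<^sub>0) * w)" for w
        by (simp add: inner_complex_def)
      fix w assume "w \<in> sphere (0::complex) r"
      then obtain t where t: "t\<^sub>0 \<le> t" "t \<le> t\<^sub>0 + 2 * pi" "w = Z t" using onto by blast
      have "Im (cis (- \<phi> t\<^sub>0) * f (Z t\<^sub>0)) \<le> Im (cis (- \<phi> t\<^sub>0) * f (Z t))"
      proof (rule closed_curve_left_of_tangent[OF Td polar \<phi>d _ \<phi>per _ t(1,2)])
        show "deriv \<phi> \<theta> > 0" for \<theta> using deriv[of \<theta>] \<alpha> by simp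
      qed (simp add: Zper)
      then show "(\<i> * cis (\<phi> t\<^sub>0)) \<bullet> f z \<le> (\<i> * cis (\<phi> t\<^sub>0)) \<bullet> f w" unfolding inner t0 t(3) .
    qed simp
  qed
qed

theorem corollary3p8:
  fixes f :: "complex \<Rightarrow> complex" and \<alpha> :: real
  assumes "f \<in> class_KH0" and "0 \<le> \<alpha>" and "\<alpha> < 1"
  shows "\<exists>rC::real.
    {r. 0 < r \<and> r < 1 \<and>
        2 * (1 - \<alpha>) * (1 - r) ^ 4 + \<alpha> * (1 - r) ^ 2 - (r ^ 2 + 4 * r + 1) = 0} = {rC} \<and>
    fully_convex_of_order \<alpha> f rC"
proof -
  have "f \<in> class_SH" and conv: "convex (f ` ball 0 1)" and "deriv_zbar f 0 = 0"
    using assms(1) by (auto simp: class_KH0_def)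
  from \<open>f \<in> class_SH\<close> obtain h g where hg: "h holomorphic_on ball 0 1" "g holomorphic_on ball 0 1"
    and f: "\<And>z. z \<in> ball 0 1 \<Longrightarrow> f z = h z + cnj (g z)"
    and sense: "\<And>z. z \<in> ball 0 1 \<Longrightarrow> cmod (deriv g z) < cmod (deriv h z)"
    and inj: "inj_on f (ball 0 1)"
    unfolding class_SH_def by blast
  have "deriv_zbar f 0 = cnj (deriv g 0)"
    by (rule deriv_zbar_harmonic[OF holomorphic_derivI[OF hg(1) open_ball] holomorphic_derivI[OF hg(2) open_ball] open_ball _ f, of 0 0]) auto
  then have g0: "deriv g 0 = 0" using \<open>deriv_zbar f 0 = 0\<close> by simp
  obtain rC where rC: "{r. 0 < r \<and> r < 1 \<and> 2 * (1 - \<alpha>) * (1 - r) ^ 4 + \<alpha> * (1 - r) ^ 2 - (r ^ 2 + 4 * r + 1) = 0} = {rC}"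
    "\<And>r. 0 < r \<Longrightarrow> r < rC \<Longrightarrow> r < 1 \<and> 6 * r < 1 - \<alpha>"
    using radius_polynomial_root[OF assms(2,3)] by blast
  have "fully_convex_of_order \<alpha> f rC"
    unfolding fully_convex_of_order_def
  proof (intro allI impI, elim conjE, intro conjI)
    fix r assume r: "0 < r" "r < rC"
    have r': "r < 1" "6 * r < 1 - \<alpha>" using rC(2)[OF r] by auto
    show "inj_on f (sphere 0 r)" by (rule inj_on_subset[OF inj]) (use r' in auto)
    note circle = fully_convex_on_circle[OF hg f sense g0 inj conv assms(2) r(1) r'(2)]
    show "convex_curve (f ` sphere 0 r)" by (rule circle(1))
    show "\<exists>(T :: real \<Rightarrow> complex) (\<phi> :: real \<Rightarrow> real).
           (\<forall>\<theta>. ((\<lambda>t. f (of_real r * cis t)) has_vector_derivative T \<theta>) (at \<theta>) \<and>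
                T \<theta> \<noteq> 0 \<and> T \<theta> = of_real (norm (T \<theta>)) * cis (\<phi> \<theta>)) \<and>
           (\<forall>\<theta>. \<phi> differentiable at \<theta>) \<and>
           (\<forall>\<theta>\<in>{0..2 * pi}. deriv \<phi> \<theta> > \<alpha>)"
      by (rule circle(2))
  qed
  then show ?thesis using rC(1) by blast
qed

end
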